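(* Let $T\in\mathcal B(\mathcal H_n)$ be self-adjoint. Then there exists a spectral measure $E$ on the Borel $\sigma$-algebra $\mathscr B(\sigma_S(T))$ such that $$T=\int_{\sigma_S(T)}t\,dE(t).$$ The spectral measure $E$ is unique in the sense that if $F$ is a spectral measure on $\mathscr B(\mathbb R)$ such that $T=\int_{\mathbb R}t\,dF(t)$, then $E(M\cap\sigma_S(T))=F(M)$ for all $M\in\mathscr B(\mathbb R)$. Moreover, $W\in\mathcal B(\mathcal H_n)$ commutes with $T$ if and only if $WE(M)=E(M)W$ for every $M\in\mathscr B(\sigma_S(T))$.
   Context: Let $n\ge1$. $\mathbb R_n$ is the real Clifford algebra (of real dimension $2^n$) generated by $e_1,\dots,e_n$ with $e_i^2=-1$ and $e_ie_j=-e_je_i$ for $i\ne j$; it has basis $e_\alpha=e_{i_1}\cdots e_{i_r}$ for $\alpha=\{i_1<\cdots<i_r\}\subseteq\{1,\dots,n\}$, $e_\emptyset=1$. For $a=\sum_\alpha a_\alpha e_\alpha$ ($a_\alpha\in\mathbb R$): $\mathrm{Re}(a)=a_\emptyset$, $|a|=(\sum_\alpha a_\alpha^2)^{1/2}$, and $a\mapsto\bar a$ is the real-linear map with $\overline{ab}=\bar b\,\bar a$, $\bar 1=1$, $\bar e_j=-e_j$. $\mathcal H$ is a real Hilbert space and $\mathcal H_n=\mathcal H\otimes\mathbb R_n$ is the two-sided Clifford module of elements $x=\sum_\alpha x_\alpha e_\alpha$ ($x_\alpha\in\mathcal H$), with $\langle x,y\rangle=\sum_{\alpha,\beta}\bar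 e_\beta e_\alpha\langle x_\alpha,y_\beta\rangle_{\mathcal H}\in\mathbb R_n$ (so $\langle xa,y\rangle=\langle x,y\rangle a$) and norm $\|x\|=(\sum_\alpha\|x_\alpha\|^2)^{1/2}=(\mathrm{Re}\langle x,x\rangle)^{1/2}$. $\mathcal B(\mathcal H_n)$ is the set of everywhere defined bounded right $\mathbb R_n$-linear operators on $\mathcal H_n$; $T$ is self-adjoint if $\langle Tx,y\rangle=\langle x,Ty\rangle$ for all $x,y$. $\mathbb R^{n+1}$ is identified with the paravectors $s=s_0+\sum_{j=1}^n s_je_j$. With $\mathcal Q_s(T)=T^2-2\mathrm{Re}(s)T+|s|^2I$, $\rho_S(T)$ is the set of $s\in\mathbb R^{n+1}$ such that $\mathcal Q_s(T)$ has trivial kernel, dense range, and bounded inverse on its range; $\sigma_S(T)=\mathbb R^{n+1}\setminus\rho_S(T)$. (For self-adjoint $T$, $\sigma_S(T)\subseteq\mathbb R$.) A spectral measure on a $\sigma$-algebra $\mathscr A$ of subsets of $\Omega$ is a map $E$ from $\mathscr A$ to the orthogonal projections on $\mathcal H_n$ (self-adjoint $P\in\mathcal B(\mathcal H_n)$ with $P^2=P$) that is countably additive in the strong operator topology with $E(\Omega)=I$. For bounded measurable real $f$, $\int f\,dE$ is the operator norm limit of $\sum_jc_jE(M_j)$ over simple functions $\sum_jc_j\chi_{M_j}$ converging uniformly to $f$; for unbounded real measurable $f$, $\int f\,dE$ has domain $\{x:\int|f|^2\,d(\mathrm{Re}\langle E(t)x,x\rangle)<\infty\}$ and acts by $x\mapsto\lim_j(\int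 f\chi_{M_j}dE)x$, where $M_j\subseteq M_{j+1}$, $f$ is bounded on each $M_j$ and $E(\cup_jM_j)=I$. *)

theory Defs
  imports "HOL-Analysis.Analysis"
begin

section \<open>The Clifford algebra\<close>

text \<open>
  The generators are indexed by a finite linearly ordered type \<open>'n\<close>, so \<open>n = CARD('n)\<close>.
  An element is the vector of its coefficients, one for each subset of the index set; the library's
  norm on this vector type is the Euclidean norm of the coefficients.  The library's \<open>*\<close> on
  vectors is the componentwise product and is not used: the Clifford product is \<open>cl_mult\<close>.
\<close>

type_synonym 'n clifford = "real ^ ('n set)"

definition cl_basis :: "'n::{finite,linorder} set \<Rightarrow> 'n clifford" where
  "cl_basis A = axis A 1"

text \<open>
  Sorting the word \<open>e\<^sub>A e\<^sub>B\<close> costs a factor \<open>-1\<close> for each \<open>i \<in> A\<close>, \<open>j \<in> B\<close> with \<open>j < i\<close>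
  (anticommutation) and one for each \<open>i = j\<close> (from \<open>e\<^sub>i\<^sup>2 = -1\<close>).
\<close>

definition cl_sign :: "'n::{finite,linorder} set \<Rightarrow> 'n set \<Rightarrow> real" where
  "cl_sign A B = (\<Prod>i\<in>A. \<Prod>j\<in>B. if j \<le> i then - 1 else 1)"

definition cl_mult :: "'n::{finite,linorder} clifford \<Rightarrow> 'n clifford \<Rightarrow> 'n clifford" where
  "cl_mult a b = (\<Sum>A\<in>UNIV. \<Sum>B\<in>UNIV. (a $ A * b $ B * cl_sign A B) *\<^sub>R cl_basis (sym_diff A B))"

definition cl_Re :: "'n::{finite,linorder} clifford \<Rightarrow> real" where
  "cl_Re a = a $ {}"

definition cl_of_real :: "real \<Rightarrow> 'n::{finite,linorder} clifford" where
  "cl_of_real r = r *\<^sub>R cl_basis {}"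

text \<open>
  Reversing a product of \<open>r\<close> distinct generators gives \<open>(-1)\<close> to the power \<open>r(r-1)/2\<close>, and
  \<open>e\<^sub>j \<mapsto> -e\<^sub>j\<close> another \<open>(-1)\<close> to the power \<open>r\<close>.
\<close>

definition cl_conj :: "'n::{finite,linorder} clifford \<Rightarrow> 'n clifford" where
  "cl_conj a = (\<chi> A. (- 1) ^ (card A * (card A + 1) div 2) * a $ A)"

definition paravectors :: "'n::{finite,linorder} clifford set" where
  "paravectors = {s. \<forall>A. card A > 1 \<longrightarrow> s $ A = 0}"


text \<open>
  The following facts determine \<open>cl_mult\<close> and \<open>cl_conj\<close>: the product is bilinear, associative and
  unital, the \<open>e\<^sub>i\<close> satisfy the Clifford relations, \<open>e\<^sub>A\<close> is the ordered product of its generators,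
  and the conjugation is a linear anti-automorphism.
\<close>

lemma cl_sign_sq [simp]: "cl_sign A B * cl_sign A B = 1"
  unfolding cl_sign_def prod.distrib[symmetric] by (rule prod.neutral, rule ballI, rule prod.neutral) auto

lemma prod_sym_diff:
  fixes f :: "'a::finite \<Rightarrow> real"
  assumes "\<And>i. f i * f i = 1"
  shows "prod f (sym_diff A B) = prod f A * prod f B"
proof -
  have A: "prod f A = prod f (A - B) * prod f (A \<inter> B)"
    by (metis Diff_disjoint Int_Diff_Un finite_code inf_commute inf_sup_aci(1) prod.Int_Diff mult.commute)
  have B: "prod f B = prod f (B - A) * prod f (A \<inter> B)"
    by (metis finite_code inf_commute prod.Int_Diff mult.commute)
  have i: "prod f (A \<inter> B) * prod f (A \<inter> B) = 1"
    unfolding prod.distrib[symmetric] by (rule prod.neutral) (simp add: assms)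
  have "prod f (sym_diff A B) = prod f (A - B) * prod f (B - A)"
    by (rule prod.union_disjoint) auto
  with A B i show ?thesis by (simp add: algebra_simps)
qed

lemma cl_sign_sym_diff_left: "cl_sign (sym_diff A B) C = cl_sign A C * cl_sign B C"
  unfolding cl_sign_def
  by (rule prod_sym_diff) (auto simp: prod.distrib[symmetric] intro!: prod.neutral)

lemma cl_sign_sym_diff_right: "cl_sign A (sym_diff B C) = cl_sign A B * cl_sign A C"
proof -
  have "(\<Prod>j\<in>sym_diff B C. if j \<le> i then - 1 else (1::real)) =
    (\<Prod>j\<in>B. if j \<le> i then - 1 else 1) * (\<Prod>j\<in>C. if j \<le> i then - 1 else 1)" for i
    by (rule prod_sym_diff) auto
  then show ?thesis unfolding cl_sign_def by (simp add: prod.distrib)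
qed

lemma cl_basis_nth: "cl_basis A $ B = (if B = A then 1 else 0)"
  by (simp add: cl_basis_def axis_def)

lemma cl_mult_basis: "cl_mult (cl_basis A) (cl_basis B) = cl_sign A B *\<^sub>R cl_basis (sym_diff A B)"
proof -
  have "cl_mult (cl_basis A) (cl_basis B) = (\<Sum>A'\<in>UNIV. if A' = A then (\<Sum>B'\<in>UNIV. if B' = B then cl_sign A B *\<^sub>R cl_basis (sym_diff A B) else 0) else 0)"
    unfolding cl_mult_def by (rule sum.cong[OF refl]) (simp add: cl_basis_nth if_distrib[of "\<lambda>r. r * _"] if_distrib[of "\<lambda>r. r *\<^sub>R _"] cong: if_cong)
  also have "\<dots> = cl_sign A B *\<^sub>R cl_basis (sym_diff A B)"
    by (simp only: sum.delta finite UNIV_I if_True)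
  finally show ?thesis .
qed

lemma linear_cl_mult_left: "linear (\<lambda>a. cl_mult a b)"
  unfolding cl_mult_def
  by (rule linearI) (simp_all add: algebra_simps scaleR_add_left sum.distrib scaleR_sum_right)

lemma linear_cl_mult_right: "linear (cl_mult a)"
  unfolding cl_mult_def
  by (rule linearI) (simp_all add: algebra_simps scaleR_add_left sum.distrib scaleR_sum_right)

lemma linear_eq_cl_basis:
  assumes "linear f" "linear g" "\<And>A. f (cl_basis A) = g (cl_basis A)"
  shows "f = g"
proof -
  have "f b = g b" if "b \<in> Basis" for b
    using that assms(3) by (auto simp: Basis_vec_def cl_basis_def)
  then show ?thesis using linear_eq_stdbasis[OF assms(1,2)] by blast
qed

lemma sym_diff_assoc: "sym_diff (sym_diff A B) C = sym_diff A (sym_diff B C)" by auto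

lemma cl_mult_scaleR: "cl_mult (r *\<^sub>R a) b = r *\<^sub>R cl_mult a b" "cl_mult a (r *\<^sub>R b) = r *\<^sub>R cl_mult a b"
  using linear_scale[OF linear_cl_mult_left] linear_scale[OF linear_cl_mult_right] by blast+

lemma cl_mult_assoc: "cl_mult (cl_mult a b) c = cl_mult a (cl_mult b c)"
proof -
  have 1: "cl_mult (cl_mult (cl_basis A) (cl_basis B)) (cl_basis C) =
        cl_mult (cl_basis A) (cl_mult (cl_basis B) (cl_basis C))" for A B C :: "'a set"
    unfolding cl_mult_basis cl_mult_scaleR cl_sign_sym_diff_left cl_sign_sym_diff_right sym_diff_assoc by (simp add: cl_sign_sym_diff_left cl_sign_sym_diff_right)
  have 2: "(\<lambda>c. cl_mult (cl_mult (cl_basis A) (cl_basis B)) c) = (\<lambda>c. cl_mult (cl_basis A) (cl_mult (cl_basis B) c))" for A B :: "'a set"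
    apply (rule linear_eq_cl_basis)
    subgoal by (rule linear_cl_mult_right)
    subgoal using linear_compose[OF linear_cl_mult_right linear_cl_mult_right] by (simp add: o_def)
    subgoal by (rule 1)
    done
  have 3: "(\<lambda>b. cl_mult (cl_mult (cl_basis A) b) c) = (\<lambda>b. cl_mult (cl_basis A) (cl_mult b c))" for A :: "'a set"
    apply (rule linear_eq_cl_basis)
    subgoal using linear_compose[OF linear_cl_mult_right linear_cl_mult_left] by (simp add: o_def)
    subgoal using linear_compose[OF linear_cl_mult_left linear_cl_mult_right] by (simp add: o_def)
    subgoal for B using 2[of A B] by metis
    done
  have 4: "(\<lambda>a. cl_mult (cl_mult a b) c) = (\<lambda>a. cl_mult a (cl_mult b c))"
    apply (rule linear_eq_cl_basis)
    subgoal using linear_compose[OF linear_cl_mult_left linear_cl_mult_left] by (simp add: o_def)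
    subgoal by (rule linear_cl_mult_left)
    subgoal for A using 3[of A] by metis
    done
  then show ?thesis by metis
qed

lemma cl_one: "cl_mult (cl_basis {}) a = a" "cl_mult a (cl_basis {}) = a"
proof -
  have "cl_mult (cl_basis {}) = (\<lambda>a. a)"
    by (rule linear_eq_cl_basis[OF linear_cl_mult_right linear_ident]) (simp add: cl_mult_basis cl_sign_def)
  then show "cl_mult (cl_basis {}) a = a" by metis
  have "(\<lambda>a. cl_mult a (cl_basis {})) = (\<lambda>a. a)"
    by (rule linear_eq_cl_basis[OF linear_cl_mult_left linear_ident]) (simp add: cl_mult_basis cl_sign_def)
  then show "cl_mult a (cl_basis {}) = a" by metis
qed

lemma cl_generator_sq: "cl_mult (cl_basis {i}) (cl_basis {i}) = - cl_basis {}"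
  by (simp add: cl_mult_basis cl_sign_def)

lemma cl_generators_anticommute:
  "i \<noteq> j \<Longrightarrow> cl_mult (cl_basis {i}) (cl_basis {j}) = - cl_mult (cl_basis {j}) (cl_basis {i})"
  by (auto simp add: cl_mult_basis cl_sign_def not_le insert_commute Un_commute insert_Diff_if)

lemma cl_basis_insert:
  assumes "\<And>j. j \<in> A \<Longrightarrow> i < j"
  shows "cl_basis (insert i A) = cl_mult (cl_basis {i}) (cl_basis A)"
proof -
  have "i \<notin> A" using assms by blast
  then have "sym_diff {i} A = insert i A" by auto
  moreover have "cl_sign {i} A = 1" using assms by (auto simp: cl_sign_def intro!: prod.neutral) (meson leD)
  ultimately show ?thesis by (simp only: cl_mult_basis scaleR_one)
qed

lemma cl_sign_diag: "cl_sign A A = (- 1) ^ (card A * (card A + 1) div 2)"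
proof -
  have "finite A" by simp
  then show ?thesis
  proof (induction A rule: finite_linorder_max_induct)
    case empty then show ?case by (simp add: cl_sign_def)
  next
    case (insert m A)
    then have m: "m \<notin> A" by blast
    have 1: "(\<Prod>j\<in>insert m A. if j \<le> m then - 1 else 1) = (- 1 :: real) ^ (card A + 1)"
    proof -
      have "(\<Prod>j\<in>insert m A. if j \<le> m then - 1 else 1) = (\<Prod>j\<in>insert m A. - 1 :: real)"
        using insert.hyps by (intro prod.cong) auto
      then show ?thesis using m by simp
    qed
    have 2: "(\<Prod>j\<in>insert m A. if j \<le> i then - 1 else (1::real)) = (\<Prod>j\<in>A. if j \<le> i then - 1 else 1)" if "i \<in> A" for i
      using insert.hyps that m by (simp add: not_le)
    have "cl_sign (insert m A) (insert m A) = (\<Prod>j\<in>insert m A. if j \<le> m then - 1 else 1) * (\<Prod>i\<in>A. \<Prod>j\<in>insert m A. if j \<le> i then - 1 else 1)"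
      unfolding cl_sign_def by (rule prod.insert) (use m in auto)
    also have "\<dots> = (- 1) ^ (card A + 1) * cl_sign A A"
      unfolding cl_sign_def 1 using 2 by simp
    also have "\<dots> = (- 1) ^ (card A + 1 + card A * (card A + 1) div 2)"
      by (simp add: insert.IH power_add)
    also have "card A + 1 + card A * (card A + 1) div 2 = (card A + 1) * (card A + 1 + 1) div 2"
      by simp
    finally show ?case using m by simp
  qed
qed

lemma cl_conj_basis: "cl_conj (cl_basis A) = cl_sign A A *\<^sub>R cl_basis A"
  by (auto simp: cl_conj_def vec_eq_iff cl_basis_nth cl_sign_diag)

lemma linear_cl_conj: "linear cl_conj"
  by (rule linearI) (auto simp: cl_conj_def vec_eq_iff algebra_simps)

lemma sym_diff_commute: "sym_diff A B = sym_diff B A" by auto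

lemma cl_conj_mult: "cl_conj (cl_mult a b) = cl_mult (cl_conj b) (cl_conj a)"
proof -
  have 1: "cl_conj (cl_mult (cl_basis A) (cl_basis B)) = cl_mult (cl_conj (cl_basis B)) (cl_conj (cl_basis A))" for A B :: "'a set"
  proof -
    have "cl_conj (cl_mult (cl_basis A) (cl_basis B)) =
      (cl_sign A B * cl_sign (sym_diff A B) (sym_diff A B)) *\<^sub>R cl_basis (sym_diff A B)"
      by (simp add: cl_mult_basis linear_scale[OF linear_cl_conj] cl_conj_basis)
    also have "cl_sign A B * cl_sign (sym_diff A B) (sym_diff A B) = (cl_sign A B * cl_sign A B) * (cl_sign B B * cl_sign A A * cl_sign B A)"
      by (simp only: cl_sign_sym_diff_left cl_sign_sym_diff_right mult.commute mult.left_commute)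
    also have "\<dots> *\<^sub>R cl_basis (sym_diff A B) = cl_mult (cl_conj (cl_basis B)) (cl_conj (cl_basis A))"
      by (simp add: cl_conj_basis cl_mult_scaleR cl_mult_basis sym_diff_commute[of A B] mult_ac)
    finally show ?thesis .
  qed
  have 2: "(\<lambda>b. cl_conj (cl_mult (cl_basis A) b)) = (\<lambda>b. cl_mult (cl_conj b) (cl_conj (cl_basis A)))" for A :: "'a set"
    apply (rule linear_eq_cl_basis)
    subgoal using linear_compose[OF linear_cl_mult_right linear_cl_conj] by (simp add: o_def)
    subgoal using linear_compose[OF linear_cl_conj linear_cl_mult_left] by (simp add: o_def)
    subgoal by (rule 1)
    done
  have "(\<lambda>a. cl_conj (cl_mult a b)) = (\<lambda>a. cl_mult (cl_conj b) (cl_conj a))"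
    apply (rule linear_eq_cl_basis)
    subgoal using linear_compose[OF linear_cl_mult_left linear_cl_conj] by (simp add: o_def)
    subgoal using linear_compose[OF linear_cl_conj linear_cl_mult_right] by (simp add: o_def)
    subgoal for A using 2[of A] by metis
    done
  then show ?thesis by metis
qed

lemma cl_conj_one: "cl_conj (cl_basis {}) = cl_basis {}"
  by (simp add: cl_conj_basis cl_sign_def)

lemma cl_conj_generator: "cl_conj (cl_basis {i}) = - cl_basis {i}"
  by (simp add: cl_conj_basis cl_sign_def)


section \<open>The Clifford module and its operators\<close>

text \<open>The norm of \<open>'h ^ ('n set)\<close> is the square root of the sum of the squared norms of the components.\<close>

type_synonym ('h, 'n) clmod = "'h ^ ('n set)"
type_synonym ('h, 'n) clop = "('h, 'n) clmod \<Rightarrow>\<^sub>L ('h, 'n) clmod"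

definition cl_right ::
  "('h::{real_inner,banach}, 'n::{finite,linorder}) clmod \<Rightarrow> 'n clifford \<Rightarrow> ('h, 'n) clmod" where
  "cl_right x a = (\<Sum>A\<in>UNIV. \<Sum>B\<in>UNIV. axis (sym_diff A B) ((a $ B * cl_sign A B) *\<^sub>R x $ A))"

definition cl_inner ::
  "('h::{real_inner,banach}, 'n::{finite,linorder}) clmod \<Rightarrow> ('h, 'n) clmod \<Rightarrow> 'n clifford" where
  "cl_inner x y =
    (\<Sum>A\<in>UNIV. \<Sum>B\<in>UNIV. (x $ A \<bullet> y $ B) *\<^sub>R cl_mult (cl_conj (cl_basis B)) (cl_basis A))"

definition right_linear :: "('h::{real_inner,banach}, 'n::{finite,linorder}) clop \<Rightarrow> bool" where
  "right_linear T \<longleftrightarrow> (\<forall>x a. T (cl_right x a) = cl_right (T x) a)"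

definition self_adjoint :: "('h::{real_inner,banach}, 'n::{finite,linorder}) clop \<Rightarrow> bool" where
  "self_adjoint T \<longleftrightarrow> (\<forall>x y. cl_inner (T x) y = cl_inner x (T y))"

definition orth_projection :: "('h::{real_inner,banach}, 'n::{finite,linorder}) clop \<Rightarrow> bool" where
  "orth_projection P \<longleftrightarrow> right_linear P \<and> self_adjoint P \<and> P o\<^sub>L P = P"

definition op_graph ::
  "('h::{real_inner,banach}, 'n::{finite,linorder}) clop \<Rightarrow> (('h, 'n) clmod \<times> ('h, 'n) clmod) set" where
  "op_graph T = {(x, y). y = T x}"


lemma cl_Re_inner:
  fixes x y :: "('h::{real_inner,banach}, 'n::{finite,linorder}) clmod"
  shows "cl_Re (cl_inner x y) = x \<bullet> y"
proof -
  have *: "cl_mult (cl_conj (cl_basis B)) (cl_basis A) $ {} = (if A = B then 1 else 0)" for A B :: "'n set"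
    by (auto simp: cl_conj_basis cl_mult_scaleR cl_mult_basis cl_basis_nth)
  show ?thesis
    by (simp add: cl_Re_def cl_inner_def inner_vec_def * if_distrib sum.delta cong: if_cong)
qed

lemma linear_cl_inner: "linear (\<lambda>x. cl_inner x y)"
  unfolding cl_inner_def
  by (rule linearI) (simp_all add: inner_add_left scaleR_add_left sum.distrib scaleR_sum_right)

lemma linear_cl_right:
  fixes x :: "('h::{real_inner,banach}, 'n::{finite,linorder}) clmod"
  shows "linear (cl_right x)"
proof (rule linearI)
  have *: "axis i (u + v) = axis i u + axis i v" "axis i (r *\<^sub>R u) = r *\<^sub>R axis i u"
    for i :: "'n set" and u v :: 'h and r
    by (simp_all add: axis_def vec_eq_iff)
  show "cl_right x (a + b) = cl_right x a + cl_right x b" for a b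
    unfolding cl_right_def by (simp add: scaleR_add_left distrib_right * sum.distrib)
  show "cl_right x (r *\<^sub>R a) = r *\<^sub>R cl_right x a" for r a
    unfolding cl_right_def by (simp add: * scaleR_sum_right mult.assoc flip: scaleR_scaleR)
qed

lemma cl_inner_axis: "cl_inner (axis A u) y = (\<Sum>B\<in>UNIV. (u \<bullet> y $ B) *\<^sub>R cl_mult (cl_conj (cl_basis B)) (cl_basis A))"
proof -
  have "cl_inner (axis A u) y = (\<Sum>A'\<in>UNIV. if A' = A then (\<Sum>B\<in>UNIV. (u \<bullet> y $ B) *\<^sub>R cl_mult (cl_conj (cl_basis B)) (cl_basis A)) else 0)"
    unfolding cl_inner_def by (intro sum.cong refl) (auto simp: axis_def)
  then show ?thesis by simp
qed

lemma cl_right_basis: "cl_right x (cl_basis D) = (\<Sum>A\<in>UNIV. cl_sign A D *\<^sub>R axis (sym_diff A D) (x $ A))"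
proof -
  have "(\<Sum>B\<in>UNIV. axis (sym_diff A B) ((cl_basis D $ B * cl_sign A B) *\<^sub>R x $ A)) = cl_sign A D *\<^sub>R axis (sym_diff A D) (x $ A)" for A
  proof -
    have "(\<Sum>B\<in>UNIV. axis (sym_diff A B) ((cl_basis D $ B * cl_sign A B) *\<^sub>R x $ A)) =
      (\<Sum>B\<in>UNIV. if B = D then cl_sign A D *\<^sub>R axis (sym_diff A D) (x $ A) else 0)"
      by (intro sum.cong refl) (auto simp: cl_basis_nth axis_def vec_eq_iff)
    then show ?thesis by simp
  qed
  then show ?thesis unfolding cl_right_def by simp
qed

lemma cl_inner_right: "cl_inner (cl_right x a) y = cl_mult (cl_inner x y) a"
proof -
  have 1: "cl_inner (cl_right x (cl_basis D)) y = cl_mult (cl_inner x y) (cl_basis D)" for D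
  proof -
    have "cl_inner (cl_right x (cl_basis D)) y = (\<Sum>A\<in>UNIV. \<Sum>B\<in>UNIV. (x $ A \<bullet> y $ B) *\<^sub>R cl_mult (cl_conj (cl_basis B)) (cl_sign A D *\<^sub>R cl_basis (sym_diff A D)))"
      unfolding cl_right_basis
      by (simp add: linear_sum[OF linear_cl_inner] linear_scale[OF linear_cl_inner] cl_inner_axis cl_mult_scaleR scaleR_sum_right mult.commute)
    also have "\<dots> = (\<Sum>A\<in>UNIV. \<Sum>B\<in>UNIV. (x $ A \<bullet> y $ B) *\<^sub>R cl_mult (cl_mult (cl_conj (cl_basis B)) (cl_basis A)) (cl_basis D))"
      by (simp only: cl_mult_assoc cl_mult_basis)
    also have "\<dots> = cl_mult (cl_inner x y) (cl_basis D)"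
      unfolding cl_inner_def
      by (simp add: linear_sum[OF linear_cl_mult_left] cl_mult_scaleR)
    finally show ?thesis .
  qed
  have "(\<lambda>a. cl_inner (cl_right x a) y) = cl_mult (cl_inner x y)"
    apply (rule linear_eq_cl_basis)
    subgoal using linear_compose[OF linear_cl_right linear_cl_inner] by (simp add: o_def)
    subgoal by (rule linear_cl_mult_right)
    subgoal by (rule 1)
    done
  then show ?thesis by metis
qed


section \<open>The S-spectrum\<close>

definition Q_op ::
  "'n::{finite,linorder} clifford \<Rightarrow> ('h::{real_inner,banach}, 'n) clop \<Rightarrow> ('h, 'n) clop" where
  "Q_op s T = (T o\<^sub>L T) - (2 * cl_Re s) *\<^sub>R T + (norm s)\<^sup>2 *\<^sub>R id_blinfun"

definition S_resolvent :: "('h::{real_inner,banach}, 'n::{finite,linorder}) clop \<Rightarrow> 'n clifford set" where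
  "S_resolvent T = {s \<in> paravectors.
     (\<forall>x. Q_op s T x = 0 \<longrightarrow> x = 0) \<and>
     closure (range (Q_op s T)) = UNIV \<and>
     (\<exists>C. \<forall>y\<in>range (Q_op s T). norm (inv (Q_op s T) y) \<le> C * norm y)}"

definition S_spectrum :: "('h::{real_inner,banach}, 'n::{finite,linorder}) clop \<Rightarrow> 'n clifford set" where
  "S_spectrum T = paravectors - S_resolvent T"


lemma coercive_surj:
  fixes Q :: "'a::{real_inner,banach} \<Rightarrow>\<^sub>L 'a"
  assumes c: "c > 0" and Q: "\<And>x. c * (norm x)\<^sup>2 \<le> Q x \<bullet> x"
  shows "range Q = UNIV"
proof -
  define K where "K = norm Q + c"
  have K: "K > 0" "K \<ge> c" "K \<ge> norm Q" using c by (auto simp: K_def add_nonneg_pos)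
  define \<tau> where "\<tau> = c / K\<^sup>2"
  define q where "q = sqrt (1 - c\<^sup>2 / K\<^sup>2)"
  have ck: "c\<^sup>2 / K\<^sup>2 \<le> 1" "c\<^sup>2 / K\<^sup>2 > 0" using c K by (auto intro: power_mono)
  then have q: "0 \<le> q" "q < 1" by (auto simp: q_def)
  have est: "norm (x - \<tau> *\<^sub>R Q x) \<le> q * norm x" for x
  proof -
    have nQ: "norm (Q x) \<le> K * norm x"
      by (rule order_trans[OF norm_blinfun]) (simp add: K mult_right_mono)
    have "(norm (x - \<tau> *\<^sub>R Q x))\<^sup>2 = (norm x)\<^sup>2 - 2 * \<tau> * (Q x \<bullet> x) + \<tau>\<^sup>2 * (norm (Q x))\<^sup>2"
      unfolding power2_norm_eq_inner
      by (simp add: inner_diff_left inner_diff_right inner_commute[of x "Q x"] power2_eq_square algebra_simps del: dot_square_norm)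
    also have "\<dots> \<le> (norm x)\<^sup>2 - 2 * \<tau> * (c * (norm x)\<^sup>2) + \<tau>\<^sup>2 * (K * norm x)\<^sup>2"
    proof -
      have "2 * \<tau> * (c * (norm x)\<^sup>2) \<le> 2 * \<tau> * (Q x \<bullet> x)"
        using Q[of x] c K by (intro mult_left_mono) (auto simp: \<tau>_def)
      moreover have "\<tau>\<^sup>2 * (norm (Q x))\<^sup>2 \<le> \<tau>\<^sup>2 * (K * norm x)\<^sup>2"
        using nQ by (intro mult_left_mono power_mono) auto
      ultimately show ?thesis by linarith
    qed
    also have "\<dots> = (q * norm x)\<^sup>2"
      using K c ck by (simp add: q_def \<tau>_def power_mult_distrib field_simps power2_eq_square)
    finally show ?thesis using q by (meson mult_nonneg_nonneg norm_ge_zero power2_le_imp_le)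
  qed
  have "\<exists>x. Q x = f" for f
  proof -
    have "\<exists>!x. x - \<tau> *\<^sub>R (Q x - f) = x"
    proof (rule banach_fix_type[OF q], intro allI)
      fix x y
      have "(x - \<tau> *\<^sub>R (Q x - f)) - (y - \<tau> *\<^sub>R (Q y - f)) = (x - y) - \<tau> *\<^sub>R Q (x - y)"
        by (simp add: blinfun.diff_right algebra_simps)
      then show "dist (x - \<tau> *\<^sub>R (Q x - f)) (y - \<tau> *\<^sub>R (Q y - f)) \<le> q * dist x y"
        unfolding dist_norm using est[of "x - y"] by (simp only:)
    qed
    then show ?thesis using c K by (auto simp: \<tau>_def)
  qed
  then show ?thesis by (metis surjI UNIV_I full_SetCompr_eq subsetI subset_antisym mem_Collect_eq surj_def)
qed

text \<open>
  The S-spectrum of a self-adjoint operator lies on the real axis, so that \<open>cl_Re\<close> is the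
  coordinate function \<open>t\<close> on it.
\<close>

lemma S_spectrum_real:
  assumes T: "self_adjoint T"
  shows "S_spectrum T \<subseteq> range cl_of_real"
proof
  fix s assume s: "s \<in> S_spectrum T"
  show "s \<in> range cl_of_real"
  proof (rule ccontr)
    assume ns: "s \<notin> range cl_of_real"
    define c where "c = (norm s)\<^sup>2 - (cl_Re s)\<^sup>2"
    have nrm: "(norm s)\<^sup>2 = (cl_Re s)\<^sup>2 + (\<Sum>A\<in>-{{}}. (s $ A)\<^sup>2)"
    proof -
      have "(norm s)\<^sup>2 = (\<Sum>A\<in>UNIV. (s $ A)\<^sup>2)"
        by (simp add: norm_vec_def L2_set_def sum_nonneg)
      also have "\<dots> = (s $ {})\<^sup>2 + (\<Sum>A\<in>UNIV - {{}}. (s $ A)\<^sup>2)"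
        by (rule sum.remove) auto
      finally show ?thesis by (simp add: cl_Re_def Compl_eq_Diff_UNIV)
    qed
    have c: "c > 0"
    proof (rule ccontr)
      assume "\<not> c > 0"
      then have "(\<Sum>A\<in>-{{}}. (s $ A)\<^sup>2) = 0"
        using nrm sum_nonneg[of "-{{}}" "\<lambda>A. (s $ A)\<^sup>2"] by (simp add: c_def)
      then have "s $ A = 0" if "A \<noteq> {}" for A using that by (subst (asm) sum_nonneg_eq_0_iff) auto
      then have "s = cl_of_real (cl_Re s)"
        by (auto simp: cl_of_real_def cl_Re_def vec_eq_iff cl_basis_nth)
      with ns show False by blast
    qed
    let ?Q = "Q_op s T"
    have sym: "T x \<bullet> y = x \<bullet> T y" for x y
      using T unfolding self_adjoint_def by (metis cl_Re_inner)
    have co: "c * (norm x)\<^sup>2 \<le> ?Q x \<bullet> x" for x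
    proof -
      have "?Q x \<bullet> x = T x \<bullet> T x - 2 * cl_Re s * (T x \<bullet> x) + (norm s)\<^sup>2 * (norm x)\<^sup>2"
        by (simp add: Q_op_def plus_blinfun.rep_eq minus_blinfun.rep_eq scaleR_blinfun.rep_eq inner_diff_left inner_add_left sym[of "T x" x] power2_norm_eq_inner)
      also have "\<dots> = (norm (T x - cl_Re s *\<^sub>R x))\<^sup>2 + c * (norm x)\<^sup>2"
        unfolding power2_norm_eq_inner c_def
        by (simp add: inner_diff_left inner_diff_right inner_commute[of x "T x"] power2_eq_square algebra_simps del: dot_square_norm)
      finally show ?thesis by simp
    qed
    have lower: "c * norm x \<le> norm (?Q x)" for x
    proof (cases "x = 0")
      case False
      have "c * norm x * norm x \<le> norm (?Q x) * norm x"
        using co[of x] norm_cauchy_schwarz[of "?Q x" x] by (simp add: power2_eq_square)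
      then show ?thesis using False by simp
    qed simp
    have ker: "x = 0" if "?Q x = 0" for x
      using lower[of x] that c by (simp add: mult_le_0_iff)
    have surj: "range ?Q = UNIV" by (rule coercive_surj[OF c co])
    have "norm (inv ?Q y) \<le> (1 / c) * norm y" for y
      using lower[of "inv ?Q y"] surj c by (simp add: surj_f_inv_f field_simps)
    then have "\<exists>C. \<forall>y\<in>range ?Q. norm (inv ?Q y) \<le> C * norm y" by blast
    then have "s \<in> S_resolvent T"
      using s ker surj unfolding S_resolvent_def S_spectrum_def by auto
    with s show False by (simp add: S_spectrum_def)
  qed
qed


section \<open>Spectral measures and spectral integrals\<close>

text \<open>
  Of the argument \<open>M\<close> of type \<open>'a measure\<close> only the underlying measurable space is used;
  the values of \<open>E\<close> outside \<open>sets M\<close> are irrelevant.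
\<close>

definition spectral_measure ::
  "'a measure \<Rightarrow> ('a set \<Rightarrow> ('h::{real_inner,banach}, 'n::{finite,linorder}) clop) \<Rightarrow> bool" where
  "spectral_measure M E \<longleftrightarrow>
     (\<forall>A\<in>sets M. orth_projection (E A)) \<and>
     E (space M) = id_blinfun \<and>
     (\<forall>A :: nat \<Rightarrow> 'a set. range A \<subseteq> sets M \<longrightarrow> disjoint_family A \<longrightarrow>
        (\<forall>x. (\<lambda>i. E (A i) x) sums E (\<Union>i. A i) x))"

definition spectral_integral_simple ::
  "'a measure \<Rightarrow> ('a set \<Rightarrow> ('h::{real_inner,banach}, 'n::{finite,linorder}) clop) \<Rightarrow>
   ('a \<Rightarrow> real) \<Rightarrow> ('h, 'n) clop" where
  "spectral_integral_simple M E g = (\<Sum>c\<in>g ` space M. c *\<^sub>R E (g -` {c} \<inter> space M))"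

definition spectral_integral_bounded ::
  "'a measure \<Rightarrow> ('a set \<Rightarrow> ('h::{real_inner,banach}, 'n::{finite,linorder}) clop) \<Rightarrow>
   ('a \<Rightarrow> real) \<Rightarrow> ('h, 'n) clop" where
  "spectral_integral_bounded M E f =
     (THE L. \<exists>g. (\<forall>k. simple_function M (g k)) \<and>
                 uniform_limit (space M) g f sequentially \<and>
                 (\<lambda>k. spectral_integral_simple M E (g k)) \<longlonglongrightarrow> L)"

definition scalar_measure ::
  "'a measure \<Rightarrow> ('a set \<Rightarrow> ('h::{real_inner,banach}, 'n::{finite,linorder}) clop) \<Rightarrow>
   ('h, 'n) clmod \<Rightarrow> 'a measure" where
  "scalar_measure M E x = measure_of (space M) (sets M) (\<lambda>A. ennreal (cl_Re (cl_inner (E A x) x)))"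

definition spectral_domain ::
  "'a measure \<Rightarrow> ('a set \<Rightarrow> ('h::{real_inner,banach}, 'n::{finite,linorder}) clop) \<Rightarrow>
   ('a \<Rightarrow> real) \<Rightarrow> ('h, 'n) clmod set" where
  "spectral_domain M E f = {x. (\<integral>\<^sup>+t. ennreal (\<bar>f t\<bar>\<^sup>2) \<partial>scalar_measure M E x) < \<infinity>}"

definition bounding_sequence ::
  "'a measure \<Rightarrow> ('a set \<Rightarrow> ('h::{real_inner,banach}, 'n::{finite,linorder}) clop) \<Rightarrow>
   ('a \<Rightarrow> real) \<Rightarrow> (nat \<Rightarrow> 'a set) \<Rightarrow> bool" where
  "bounding_sequence M E f S \<longleftrightarrow>
     range S \<subseteq> sets M \<and> incseq S \<and> (\<forall>j. bounded (f ` S j)) \<and> E (\<Union>j. S j) = id_blinfun"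

text \<open>
  The integral is in general an unbounded operator and is represented by its graph, so that
  \<open>op_graph T = spectral_integral M E f\<close> also says that the integral is everywhere defined.
\<close>

definition spectral_integral ::
  "'a measure \<Rightarrow> ('a set \<Rightarrow> ('h::{real_inner,banach}, 'n::{finite,linorder}) clop) \<Rightarrow>
   ('a \<Rightarrow> real) \<Rightarrow> (('h, 'n) clmod \<times> ('h, 'n) clmod) set" where
  "spectral_integral M E f =
     (if bounded (f ` space M) then op_graph (spectral_integral_bounded M E f)
      else {(x, y). x \<in> spectral_domain M E f \<and>
              (\<exists>S. bounding_sequence M E f S \<and>
                 (\<lambda>j. spectral_integral_bounded M E (\<lambda>t. f t * indicator (S j) t) x) \<longlonglongrightarrow> y)})"

end

theory Submission
  imports Defs "HOL-Probability.Distribution_Functions"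
begin

text \<open>
  The real Hilbert space structure suffices: a Clifford-linear operator is self-adjoint for the
  Clifford-valued inner product iff it is symmetric for its real part, and right linearity
  means commuting with the bounded operators \<open>x \<mapsto> xa\<close>, so it is inherited by everything that commutes
  with the whole commutant of \<open>T\<close>.

  Let \<open>|A|\<close> be the positive square root of \<open>A\<^sup>2\<close>, where \<open>A = T - t\<close>. The projection \<open>E\<^sub>t\<close> onto the
  kernel of the positive part \<open>(|A| + A) / 2\<close> satisfies \<open>T \<le> t\<close> on its range and \<open>T > t\<close> on its kernel,
  and it is the only projection commuting with \<open>T\<close> that does; monotonicity and right continuity in \<open>t\<close>
  follow from this characterisation. So \<open>t \<mapsto> \<parallel>E\<^sub>t x\<parallel>\<^sup>2\<close> is the distribution function of a
  finite measure \<open>\<mu>\<^sub>x\<close>, and the sets \<open>M\<close> for which some projection \<open>P\<close> satisfies \<open>\<parallel>P x\<parallel>\<^sup>2 = \<mu>\<^sub>x(M)\<close> for all \<open>x\<close>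
  form a Dynkin system containing the half-lines and so include all Borel sets. For uniqueness,
  any \<open>F\<close> with \<open>T = \<integral> t dF\<close> has \<open>T \<le> t\<close> on the range and \<open>T > t\<close> on the kernel of \<open>F(-\<infinity>, t]\<close>, so that this
  projection is \<open>E\<^sub>t\<close>.
\<close>

section \<open>Symmetric operators and orthogonal projections\<close>

definition sym_op :: "('a::real_inner \<Rightarrow>\<^sub>L 'a) \<Rightarrow> bool" where
  "sym_op A \<longleftrightarrow> (\<forall>x y. A x \<bullet> y = x \<bullet> A y)"

definition proj_op :: "('a::real_inner \<Rightarrow>\<^sub>L 'a) \<Rightarrow> bool" where
  "proj_op P \<longleftrightarrow> sym_op P \<and> P o\<^sub>L P = P"

lemma sym_opD: "sym_op A \<Longrightarrow> A x \<bullet> y = x \<bullet> A y"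
  by (simp add: sym_op_def)

lemma compose_eqD: "A o\<^sub>L B = C o\<^sub>L D \<Longrightarrow> A (B x) = C (D x)"
  by (metis blinfun_apply_blinfun_compose)

lemma proj_op_idem: "proj_op P \<Longrightarrow> P (P x) = P x"
  by (metis proj_op_def blinfun_apply_blinfun_compose)

lemma proj_op_inner: "proj_op P \<Longrightarrow> P x \<bullet> y = x \<bullet> P y"
  by (simp add: proj_op_def sym_op_def)

lemma proj_op_inner_self: "proj_op P \<Longrightarrow> P x \<bullet> x = (norm (P x))\<^sup>2"
  by (metis power2_norm_eq_inner proj_op_idem proj_op_inner)

lemma proj_op_pythagoras: "proj_op P \<Longrightarrow> (norm x)\<^sup>2 = (norm (P x))\<^sup>2 + (norm (x - P x))\<^sup>2"
  using proj_op_inner_self[of P x]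
  by (simp add: power2_norm_eq_inner inner_diff_left inner_diff_right inner_commute del: dot_square_norm)

lemma proj_op_norm_le: "proj_op P \<Longrightarrow> norm (P x) \<le> norm x"
  by (rule power2_le_imp_le) (simp_all add: proj_op_pythagoras[of P x])

lemma proj_op_complement: "proj_op P \<Longrightarrow> proj_op (id_blinfun - P)"
  by (auto simp: proj_op_def sym_op_def blinfun.bilinear_simps inner_diff_left inner_diff_right
      intro!: blinfun_eqI) (metis blinfun_apply_blinfun_compose)

lemma proj_op_0: "proj_op 0"
  by (auto simp: proj_op_def sym_op_def)

lemma proj_op_id: "proj_op id_blinfun"
  by (auto simp: proj_op_def sym_op_def intro!: blinfun_eqI)

lemma sym_op_scaleR: "sym_op A \<Longrightarrow> sym_op (c *\<^sub>R A)"
  by (simp add: sym_op_def blinfun.bilinear_simps)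

lemma sym_op_add: "sym_op A \<Longrightarrow> sym_op B \<Longrightarrow> sym_op (A + B)"
  by (simp add: sym_op_def blinfun.bilinear_simps inner_add_left inner_add_right)

lemma sym_op_diff: "sym_op A \<Longrightarrow> sym_op B \<Longrightarrow> sym_op (A - B)"
  by (simp add: sym_op_def blinfun.bilinear_simps inner_diff_left inner_diff_right)

lemma sym_op_id: "sym_op id_blinfun"
  by (simp add: sym_op_def)

lemma sym_op_sum: "(\<And>i. i \<in> I \<Longrightarrow> sym_op (A i)) \<Longrightarrow> sym_op (\<Sum>i\<in>I. A i)"
  by (simp add: sym_op_def blinfun.sum_left inner_sum_left inner_sum_right)

lemma sym_op_compose:
  "sym_op A \<Longrightarrow> sym_op B \<Longrightarrow> A o\<^sub>L B = B o\<^sub>L A \<Longrightarrow> sym_op (A o\<^sub>L B)"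
  unfolding sym_op_def by (metis blinfun_apply_blinfun_compose)

lemma sym_op_limit:
  assumes "\<And>n. sym_op (A n)" "A \<longlonglongrightarrow> L"
  shows "sym_op L"
  unfolding sym_op_def
proof (intro allI)
  fix x y
  have "(\<lambda>n. A n x \<bullet> y) \<longlonglongrightarrow> L x \<bullet> y" "(\<lambda>n. x \<bullet> A n y) \<longlonglongrightarrow> x \<bullet> L y"
    using assms(2) by (auto intro!: tendsto_intros)
  then show "L x \<bullet> y = x \<bullet> L y"
    using assms(1) by (simp add: sym_op_def LIMSEQ_unique)
qed

text \<open>Polarisation: the form at \<open>x + y\<close> and \<open>x - y\<close>, together with
  the parallelogram law, controls \<open>D x \<bullet> y\<close> for every \<open>y\<close> as long
  as \<open>x\<close>.\<close>

lemma sym_op_norm_bound: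
  assumes D: "sym_op D" and e: "\<And>x. \<bar>D x \<bullet> x\<bar> \<le> e * (norm x)\<^sup>2"
  shows "norm (D x) \<le> e * norm x"
proof (cases "D x = 0 \<or> x = 0")
  case True
  show ?thesis
  proof (cases "x = 0")
    case False
    have "0 \<le> e * (norm x)\<^sup>2" using e[of x] by linarith
    with False have "0 \<le> e" by (simp add: zero_le_mult_iff)
    with True False show ?thesis by simp
  qed simp
next
  case False
  \<comment> \<open>This is \<open>D x\<close> rescaled to the length of \<open>x\<close>, so that
    \<open>D x \<bullet> y\<close> becomes \<open>norm x * norm (D x)\<close>.\<close>
  define y where "y = (norm x / norm (D x)) *\<^sub>R D x"
  have ny: "norm y = norm x" using False by (simp add: y_def)
  have "4 * (D x \<bullet> y) = D (x + y) \<bullet> (x + y) - D (x - y) \<bullet> (x - y)"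
    using sym_opD[OF D, of y x]
    by (simp add: blinfun.bilinear_simps inner_add_left inner_add_right inner_diff_left
        inner_diff_right inner_commute)
  also have "\<dots> \<le> e * (norm (x + y))\<^sup>2 + e * (norm (x - y))\<^sup>2"
    using e[of "x + y"] e[of "x - y"] by linarith
  also have "\<dots> = e * (2 * (norm x)\<^sup>2 + 2 * (norm y)\<^sup>2)"
    unfolding power2_norm_eq_inner distrib_left[symmetric]
    by (simp add: inner_add_left inner_add_right inner_diff_left inner_diff_right inner_commute
        del: dot_square_norm)
  also have "\<dots> = 4 * (e * (norm x)\<^sup>2)" by (simp add: ny)
  finally have "D x \<bullet> y \<le> e * (norm x)\<^sup>2" by simp
  moreover have "D x \<bullet> y = norm x * norm (D x)"
    using False by (simp add: y_def power2_norm_eq_inner[symmetric] power2_eq_square)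
  ultimately have "norm x * norm (D x) \<le> norm x * (e * norm x)"
    by (simp add: power2_eq_square mult_ac)
  then show ?thesis using False by simp
qed

lemma sym_op_zero:
  assumes "sym_op D" "\<And>x. D x \<bullet> x = 0"
  shows "D = 0"
  using sym_op_norm_bound[OF assms(1), of 0] assms(2) by (auto intro!: blinfun_eqI)

text \<open>For a projection the form \<open>P x \<bullet> x\<close> is the squared norm of
  \<open>P x\<close>, and a symmetric operator is determined by its form. This is what pins down a
  projection by its scalar measures.\<close>

lemma proj_op_eqI:
  assumes "proj_op P" "proj_op Q" "\<And>x. norm (P x) = norm (Q x)"
  shows "P = Q"
proof -
  have "P - Q = 0"
    using assms proj_op_inner_self[OF assms(1)] proj_op_inner_self[OF assms(2)]
    by (intro sym_op_zero) (auto simp: proj_op_def sym_op_diff blinfun.bilinear_simps inner_diff_left)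
  then show ?thesis by simp
qed

section \<open>Orthogonal projection onto a closed subspace\<close>

text \<open>A sequence in \<open>S\<close> minimising the distance to \<open>x\<close> is Cauchy,
  and its limit is a nearest point. Moving the nearest point along \<open>z\<close> cannot shorten
  the distance, which forces orthogonality.\<close>

lemma closed_subspace_foot:
  fixes S :: "'a::{real_inner,banach} set"
  assumes S: "subspace S" "closed S"
  shows "\<exists>y\<in>S. \<forall>z\<in>S. (x - y) \<bullet> z = 0"
proof -
  define d where "d = infdist x S"
  have ne: "S \<noteq> {}" using S(1) subspace_0 by blast
  have d0: "d \<ge> 0" by (simp add: d_def infdist_nonneg)
  have lb: "d\<^sup>2 \<le> (norm (x - y))\<^sup>2" if "y \<in> S" for y
    using infdist_le[OF that, of x] d0 by (simp add: d_def dist_norm power_mono)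
  have "\<exists>y\<in>S. (norm (x - y))\<^sup>2 < d\<^sup>2 + 1 / real (Suc n)" for n
  proof -
    have "d < sqrt (d\<^sup>2 + 1 / real (Suc n))"
      by (rule real_less_rsqrt) simp
    then obtain y where "y \<in> S" "dist x y < sqrt (d\<^sup>2 + 1 / real (Suc n))"
      using ne unfolding d_def by (metis infdist_notempty cINF_less_iff bdd_below_image_dist)
    moreover from this have "(norm (x - y))\<^sup>2 < (sqrt (d\<^sup>2 + 1 / real (Suc n)))\<^sup>2"
      by (intro power_strict_mono) (auto simp: dist_norm)
    ultimately show ?thesis by (auto simp del: of_nat_Suc)
  qed
  then obtain y where y: "\<And>n. y n \<in> S" "\<And>n. (norm (x - y n))\<^sup>2 < d\<^sup>2 + 1 / real (Suc n)"
    by metis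
  have est: "(norm (y m - y n))\<^sup>2 \<le> 2 / real (Suc m) + 2 / real (Suc n)" for m n
  proof -
    \<comment> \<open>The midpoint also lies in \<open>S\<close>, so its distance to
      \<open>x\<close> is at least \<open>d\<close>; the parallelogram law then makes
      \<open>y m\<close> and \<open>y n\<close> close.\<close>
    have "(1/2) *\<^sub>R (y m + y n) \<in> S" using S y by (simp add: subspace_add subspace_scale)
    from lb[OF this] have "4 * d\<^sup>2 \<le> 4 * (norm (x - (1/2) *\<^sub>R (y m + y n)))\<^sup>2" by simp
    also have "\<dots> = 2 * (norm (x - y m))\<^sup>2 + 2 * (norm (x - y n))\<^sup>2 - (norm (y m - y n))\<^sup>2"
      unfolding power2_norm_eq_inner
      by (simp add: inner_add_left inner_add_right inner_diff_left inner_diff_right inner_commute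
          field_simps del: dot_square_norm)
    finally show ?thesis using y(2)[of m] y(2)[of n] by simp
  qed
  have "Cauchy y"
  proof (rule metric_CauchyI)
    fix e :: real assume e: "e > 0"
    obtain N where N: "4 / e\<^sup>2 < real N" using reals_Archimedean2 by blast
    have "dist (y m) (y n) < e" if "m \<ge> N" "n \<ge> N" for m n
    proof -
      have N0: "real N > 0" using N e by (smt (verit) divide_pos_pos zero_less_power)
      have "2 / real (Suc k) < e\<^sup>2 / 2" if "k \<ge> N" for k
      proof -
        have "2 / real (Suc k) < 2 / real N" using that N0 by (intro divide_strict_left_mono) auto
        also have "\<dots> < e\<^sup>2 / 2" using N N0 e by (simp add: field_simps)
        finally show ?thesis .
      qed
      from this[OF that(1)] this[OF that(2)] est[of m n] have "(norm (y m - y n))\<^sup>2 < e\<^sup>2" by linarith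
      then show ?thesis using e by (simp add: dist_norm power2_less_imp_less)
    qed
    then show "\<exists>M. \<forall>m\<ge>M. \<forall>n\<ge>M. dist (y m) (y n) < e" by blast
  qed
  then obtain l where l: "y \<longlonglongrightarrow> l" using Cauchy_convergent convergent_def by blast
  have lS: "l \<in> S" using S(2) y(1) l closed_sequentially by blast
  have "(\<lambda>n. (norm (x - y n))\<^sup>2) \<longlonglongrightarrow> (norm (x - l))\<^sup>2" by (intro tendsto_intros l)
  moreover have "(\<lambda>n. d\<^sup>2 + 1 / real (Suc n)) \<longlonglongrightarrow> d\<^sup>2 + 0"
    by (intro tendsto_add tendsto_const LIMSEQ_Suc[OF lim_1_over_n])
  ultimately have ld: "(norm (x - l))\<^sup>2 \<le> d\<^sup>2"
    using y(2) by (intro LIMSEQ_le) (auto intro: less_imp_le)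
  have "(x - l) \<bullet> z = 0" if z: "z \<in> S" for z
  proof (cases "z = 0")
    case False
    \<comment> \<open>With this \<open>r\<close>, the point \<open>l + r *\<^sub>R z\<close> is the
      one nearest to \<open>x\<close> on the line through \<open>l\<close> in direction
      \<open>z\<close>.\<close>
    define r where "r = ((x - l) \<bullet> z) / (z \<bullet> z)"
    have "l + r *\<^sub>R z \<in> S" using S(1) lS z by (simp add: subspace_add subspace_scale)
    from order_trans[OF ld lb[OF this]]
    have "(norm (x - l))\<^sup>2 \<le> (norm ((x - l) - r *\<^sub>R z))\<^sup>2"
      by (simp only: diff_diff_eq)
    also have "\<dots> = (norm (x - l))\<^sup>2 - 2 * r * ((x - l) \<bullet> z) + r\<^sup>2 * (z \<bullet> z)"
      unfolding power2_norm_eq_inner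
      by (simp add: inner_diff_left inner_diff_right inner_commute power2_eq_square algebra_simps
          del: dot_square_norm)
    also have "\<dots> = (norm (x - l))\<^sup>2 - ((x - l) \<bullet> z)\<^sup>2 / (z \<bullet> z)"
      using False by (simp add: r_def power2_eq_square field_simps del: dot_square_norm)
    finally have "((x - l) \<bullet> z)\<^sup>2 / (z \<bullet> z) \<le> 0" by simp
    moreover have "z \<bullet> z > 0" using False by simp
    ultimately show ?thesis by (simp add: divide_le_0_iff del: dot_square_norm)
  qed simp
  with lS show ?thesis by blast
qed

lemma closed_subspace_projection:
  fixes S :: "'a::{real_inner,banach} set"
  assumes S: "subspace S" "closed S"
  obtains P where "proj_op P" "range (blinfun_apply P) = S" "\<And>x z. z \<in> S \<Longrightarrow> (x - P x) \<bullet> z = 0"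
proof -
  obtain p where p: "\<And>x. p x \<in> S" "\<And>x z. z \<in> S \<Longrightarrow> (x - p x) \<bullet> z = 0"
    using closed_subspace_foot[OF S] by metis
  \<comment> \<open>Orthogonality determines the foot. Linearity of \<open>p\<close> and
    \<open>p x = x\<close> on \<open>S\<close> are both read off from this.\<close>
  have uniq: "p x = y" if "y \<in> S" "\<And>z. z \<in> S \<Longrightarrow> (x - y) \<bullet> z = 0" for x y
  proof -
    have "p x - y \<in> S" using S(1) p(1) that(1) by (simp add: subspace_diff)
    then have "(p x - y) \<bullet> (p x - y) = 0"
      using p(2)[of "p x - y" x] that(2)[of "p x - y"]
      by (simp add: inner_diff_left inner_diff_right)
    then show ?thesis by simp
  qed
  have lin: "linear p"
  proof (rule linearI)
    show "p (x + y) = p x + p y" for x y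
      using p(2)[of _ x] p(2)[of _ y] S(1) p(1)
      by (intro uniq) (auto simp: subspace_add inner_add_left inner_diff_left)
    show "p (c *\<^sub>R x) = c *\<^sub>R p x" for c x
      using p(2)[of _ x] S(1) p(1)
      by (intro uniq) (auto simp: subspace_scale inner_diff_left right_diff_distrib[symmetric])
  qed
  have fix_p: "p x = x" if "x \<in> S" for x using that by (intro uniq) auto
  have sym: "p x \<bullet> y = x \<bullet> p y" for x y
    using p(2)[OF p(1)[of y], of x] p(2)[OF p(1)[of x], of y]
    by (simp add: inner_diff_left inner_diff_right inner_commute)
  have "norm (p x) \<le> norm x * 1" for x
  proof -
    have "(norm (p x))\<^sup>2 = x \<bullet> p x" using sym[of x "p x"] fix_p[OF p(1)] by (simp add: power2_norm_eq_inner)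
    also have "\<dots> \<le> norm x * norm (p x)" by (rule norm_cauchy_schwarz)
    finally show ?thesis
      by (cases "p x = 0") (auto simp: power2_eq_square)
  qed
  then have bl: "bounded_linear p"
    using lin unfolding bounded_linear_def bounded_linear_axioms_def by blast
  then have app: "blinfun_apply (Blinfun p) = p" by (rule bounded_linear_Blinfun_apply)
  show thesis
  proof
    show "proj_op (Blinfun p)"
      by (auto simp: proj_op_def sym_op_def app sym fix_p p(1) intro!: blinfun_eqI)
    show "range (blinfun_apply (Blinfun p)) = S"
      unfolding app using p(1) fix_p by (metis (no_types, lifting) image_subset_iff rangeI subset_antisym subsetI)
    show "(x - Blinfun p x) \<bullet> z = 0" if "z \<in> S" for x z using p(2)[OF that] by (simp add: app)
  qed
qed

section \<open>Absolute values and spectral projections\<close>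

lemma compose_eqI:
  fixes A B C D :: "'a::real_normed_vector \<Rightarrow>\<^sub>L 'a"
  shows "(\<And>x. A (B x) = C (D x)) \<Longrightarrow> A o\<^sub>L B = C o\<^sub>L D"
  by (rule blinfun_eqI) simp

lemma tendsto_blinfun_compose:
  assumes "A \<longlonglongrightarrow> L" "B \<longlonglongrightarrow> M"
  shows "(\<lambda>n. A n o\<^sub>L B n) \<longlonglongrightarrow> (L o\<^sub>L M)"
  by (rule bounded_bilinear.tendsto[OF bounded_bilinear_blinfun_compose assms])

lemma commute_limit:
  assumes "\<And>n. W o\<^sub>L A n = A n o\<^sub>L W" "A \<longlonglongrightarrow> L"
  shows "W o\<^sub>L L = L o\<^sub>L W"
proof -
  have "(\<lambda>n. W o\<^sub>L A n) \<longlonglongrightarrow> (W o\<^sub>L L)" "(\<lambda>n. A n o\<^sub>L W) \<longlonglongrightarrow> (L o\<^sub>L W)"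
    by (intro tendsto_blinfun_compose assms(2) tendsto_const)+
  then show ?thesis using assms(1) by (simp add: LIMSEQ_unique)
qed

lemma subspace_closure:
  fixes S :: "'a::real_normed_vector set"
  assumes S: "subspace S"
  shows "subspace (closure S)"
  unfolding subspace_def
proof (intro conjI ballI allI)
  show "0 \<in> closure S" using subspace_0[OF S] closure_subset by blast
  fix u assume "u \<in> closure S"
  then obtain x where x: "\<And>n. x n \<in> S" "x \<longlonglongrightarrow> u" unfolding closure_sequential by blast
  show "c *\<^sub>R u \<in> closure S" for c
    unfolding closure_sequential using S x
    by (intro exI[of _ "\<lambda>n. c *\<^sub>R x n"]) (auto intro: subspace_scale tendsto_scaleR)
  fix v assume "v \<in> closure S"
  then obtain y where y: "\<And>n. y n \<in> S" "y \<longlonglongrightarrow> v" unfolding closure_sequential by blast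
  show "u + v \<in> closure S"
    unfolding closure_sequential using S x y
    by (intro exI[of _ "\<lambda>n. x n + y n"]) (auto intro: subspace_add tendsto_add)
qed

section \<open>The absolute value of a symmetric operator\<close>

lemma operator_abs_contraction:
  fixes A :: "'a::{real_inner,banach} \<Rightarrow>\<^sub>L 'a"
  assumes A: "sym_op A" and nA: "norm A \<le> 1"
  shows "\<exists>R. sym_op R \<and> R o\<^sub>L R = A o\<^sub>L A \<and> (\<forall>x. 0 \<le> R x \<bullet> x) \<and>
    (\<forall>W. W o\<^sub>L A = A o\<^sub>L W \<longrightarrow> W o\<^sub>L R = R o\<^sub>L W)"
proof -
  \<comment> \<open>\<open>R = I - L\<close>, where \<open>L\<close> is the fixed point of \<open>L = (S + L\<^sup>2) / 2\<close> and \<open>S = I - A\<^sup>2\<close>; the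
    iteration is dominated by the scalar one for \<open>S = 1\<close>, which increases to \<open>1\<close>.\<close>
  define S where "S = id_blinfun - (A o\<^sub>L A)"
  define Y where "Y = rec_nat (0 :: 'a \<Rightarrow>\<^sub>L 'a) (\<lambda>_ Y. (1/2) *\<^sub>R (S + (Y o\<^sub>L Y)))"
  define y where "y = rec_nat (0::real) (\<lambda>_ y. (1 + y * y) / 2)"
  have Y: "Y 0 = 0" "\<And>n. Y (Suc n) = (1/2) *\<^sub>R (S + (Y n o\<^sub>L Y n))" by (simp_all add: Y_def)
  have y: "y 0 = 0" "\<And>n. y (Suc n) = (1 + y n * y n) / 2" by (simp_all add: y_def)
  have yb: "0 \<le> y n \<and> y n \<le> 1" for n
  proof (induction n)
    case (Suc n)
    then have "y n * y n \<le> 1" by (simp add: mult_le_one)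
    with Suc show ?case by (simp add: y)
  qed (simp add: y)
  have ymono: "y n \<le> y (Suc n)" for n
    using sum_power2_ge_zero[of "1 - y n" 0] by (simp add: y power2_eq_square algebra_simps)
  have nA': "norm (A x) \<le> norm x" for x
    using norm_blinfun[of A x] nA mult_right_mono[OF nA norm_ge_zero[of x]] by simp
  \<comment> \<open>In the expansion of the squared norm of \<open>x - A (A x)\<close> the cross
    term is \<open>- 2 * (norm (A x))\<^sup>2\<close>, which outweighs the last square because
    \<open>A\<close> is a contraction.\<close>
  have S1: "norm S \<le> 1"
  proof (rule norm_blinfun_bound)
    fix x
    define u where "u = A (A x)"
    have Sx: "S x = x - u" by (simp add: S_def u_def blinfun.bilinear_simps)
    have "u \<bullet> x = (norm (A x))\<^sup>2"
      unfolding u_def sym_opD[OF A, of "A x" x] by (rule dot_square_norm)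
    then have "(norm (S x))\<^sup>2 = (norm x)\<^sup>2 - 2 * (norm (A x))\<^sup>2 + (norm (A (A x)))\<^sup>2"
      using dot_norm_neg[of u x] by (simp add: Sx u_def norm_minus_commute)
    moreover have "(norm (A (A x)))\<^sup>2 \<le> (norm (A x))\<^sup>2" using nA'[of "A x"] by (simp add: power_mono)
    ultimately have "(norm (S x))\<^sup>2 \<le> (norm x)\<^sup>2" using zero_le_power2[of "norm (A x)"] by linarith
    then show "norm (S x) \<le> 1 * norm x" using power2_le_imp_le[of "norm (S x)" "norm x"] by simp
  qed simp
  have symS: "sym_op S"
    unfolding S_def by (intro sym_op_diff sym_op_id sym_op_compose A refl)
  have symY: "sym_op (Y n)" for n
    by (induction n) (auto simp: Y sym_op_def blinfun.bilinear_simps inner_add_left inner_add_right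
        sym_opD[OF symS])
  have comY: "W o\<^sub>L Y n = Y n o\<^sub>L W" if W: "W o\<^sub>L S = S o\<^sub>L W" for W n
  proof (induction n)
    case (Suc n)
    show ?case
      by (rule compose_eqI)
        (simp add: Y blinfun.bilinear_simps compose_eqD[OF W] compose_eqD[OF Suc])
  qed (simp add: Y)
  have YY: "Y n o\<^sub>L Y m = Y m o\<^sub>L Y n" for n m
    by (metis comY)
  have nY: "norm (Y n) \<le> y n" for n
  proof (induction n)
    case (Suc n)
    have "norm (Y n o\<^sub>L Y n) \<le> y n * y n"
      using norm_blinfun_compose[of "Y n" "Y n"] mult_mono[OF Suc Suc] yb[of n] by simp
    then have "norm (S + (Y n o\<^sub>L Y n)) \<le> 1 + y n * y n" by (intro norm_triangle_mono S1)
    then show ?case by (simp add: Y y)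
  qed (simp add: Y y)
  have dY: "norm (Y (Suc n) - Y n) \<le> y (Suc n) - y n" for n
  proof (induction n)
    case 0 then show ?case using S1 by (simp add: Y y)
  next
    case (Suc n)
    define Z z where "Z = Y (Suc n)" and "z = y (Suc n)"
    have Z: "Y (Suc (Suc n)) = (1/2) *\<^sub>R (S + (Z o\<^sub>L Z))" "Z = (1/2) *\<^sub>R (S + (Y n o\<^sub>L Y n))"
      and z: "y (Suc (Suc n)) = (1 + z * z) / 2" "z = (1 + y n * y n) / 2"
      by (simp_all only: Z_def z_def Y(2) y(2))
    have YZ: "Y n (Z x) = Z (Y n x)" for x
      unfolding Z_def by (rule compose_eqD[OF YY])
    have "Y (Suc (Suc n)) - Z = (1/2) *\<^sub>R (S + (Z o\<^sub>L Z)) - (1/2) *\<^sub>R (S + (Y n o\<^sub>L Y n))"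
      by (rule arg_cong2[where f = minus, OF Z])
    \<comment> \<open>The iterates commute, so the difference of their squares factors just as for
      the scalars \<open>z\<close> and \<open>y n\<close>.\<close>
    also have "\<dots> = (1/2) *\<^sub>R ((Z + Y n) o\<^sub>L (Z - Y n))"
      by (rule blinfun_eqI) (simp add: blinfun.bilinear_simps YZ algebra_simps)
    also have "norm \<dots> \<le> (1/2) * ((z + y n) * (z - y n))"
    proof -
      have "norm ((Z + Y n) o\<^sub>L (Z - Y n)) \<le> norm (Z + Y n) * norm (Z - Y n)"
        by (rule norm_blinfun_compose)
      also have "\<dots> \<le> (z + y n) * (z - y n)"
        using norm_triangle_mono[OF nY[of "Suc n"] nY[of n]] Suc yb[of n] yb[of "Suc n"]
        unfolding Z_def z_def by (intro mult_mono) auto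
      finally show ?thesis by simp
    qed
    also have "\<dots> = (1 + z * z) / 2 - (1 + y n * y n) / 2" by (simp add: field_simps)
    also have "\<dots> = y (Suc (Suc n)) - z" by (rule arg_cong2[where f = minus, OF z[symmetric]])
    finally show ?case by (simp only: Z_def z_def)
  qed
  have "convergent y"
    using ymono yb by (intro Bseq_monoseq_convergent BseqI'[of _ 1]) (auto simp: incseq_SucI monoseq_iff)
  then have "summable (\<lambda>n. y (Suc n) - y n)"
    by (auto simp: convergent_def intro: telescope_summable)
  then have "summable (\<lambda>n. Y (Suc n) - Y n)"
    by (rule summable_comparison_test'[where N = 0]) (rule dY)
  then have "convergent (\<lambda>n. \<Sum>k<n. Y (Suc k) - Y k)"
    by (simp add: summable_iff_convergent)
  then obtain L where L: "Y \<longlonglongrightarrow> L"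
    by (auto simp: sum_lessThan_telescope Y(1) convergent_def)
  have "(\<lambda>n. Y (Suc n)) \<longlonglongrightarrow> (1/2) *\<^sub>R (S + (L o\<^sub>L L))"
    unfolding Y by (intro tendsto_intros tendsto_blinfun_compose L)
  then have fixL: "L = (1/2) *\<^sub>R (S + (L o\<^sub>L L))"
    using LIMSEQ_unique LIMSEQ_Suc[OF L] by blast
  have nL: "norm L \<le> 1"
    using nY yb by (intro LIMSEQ_le_const2[OF tendsto_norm[OF L]]) (meson order_trans)
  define R where "R = id_blinfun - L"
  have "R o\<^sub>L R = A o\<^sub>L A"
  proof (rule compose_eqI)
    fix x
    have "2 *\<^sub>R L x = x - A (A x) + L (L x)"
      by (subst fixL) (simp add: S_def blinfun.bilinear_simps)
    then show "R (R x) = A (A x)"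
      by (simp add: R_def blinfun.bilinear_simps scaleR_2 algebra_simps)
  qed
  moreover have "0 \<le> R x \<bullet> x" for x
  proof -
    have "L x \<bullet> x \<le> norm (L x) * norm x" by (rule norm_cauchy_schwarz)
    also have "\<dots> \<le> 1 * norm x * norm x"
      using order_trans[OF norm_blinfun[of L x] mult_right_mono[OF nL norm_ge_zero[of x]]]
      by (rule mult_right_mono) simp
    finally show ?thesis
      by (simp add: R_def blinfun.bilinear_simps inner_diff_left power2_norm_eq_inner[symmetric] power2_eq_square)
  qed
  moreover have "sym_op R"
    unfolding R_def by (intro sym_op_diff sym_op_id sym_op_limit[OF symY L])
  moreover have "W o\<^sub>L R = R o\<^sub>L W" if W: "W o\<^sub>L A = A o\<^sub>L W" for W
  proof -
    have "W o\<^sub>L S = S o\<^sub>L W"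
      by (rule compose_eqI) (simp add: S_def blinfun.bilinear_simps compose_eqD[OF W])
    note com = compose_eqD[OF commute_limit[OF comY[OF this] L]]
    show ?thesis
      by (rule compose_eqI) (simp add: R_def blinfun.bilinear_simps com)
  qed
  ultimately show ?thesis by blast
qed

text \<open>Scaling by the norm reduces to a contraction; \<open>A = 0\<close> is separated because
  the scaling divides by the norm.\<close>

lemma operator_abs:
  fixes A :: "'a::{real_inner,banach} \<Rightarrow>\<^sub>L 'a"
  assumes A: "sym_op A"
  obtains R where "sym_op R" "R o\<^sub>L R = A o\<^sub>L A" "\<And>x. 0 \<le> R x \<bullet> x"
    "\<And>W. W o\<^sub>L A = A o\<^sub>L W \<Longrightarrow> W o\<^sub>L R = R o\<^sub>L W"
proof (cases "A = 0")
  case True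
  then show thesis by (intro that[of 0]) (auto simp: sym_op_def)
next
  case False
  define c where "c = norm A"
  have c: "c > 0" using False by (simp add: c_def)
  define A' where "A' = (1/c) *\<^sub>R A"
  have AA': "A = c *\<^sub>R A'" using c by (simp add: A'_def)
  have "sym_op A'" "norm A' \<le> 1" using A c by (auto simp: A'_def c_def intro: sym_op_scaleR)
  from operator_abs_contraction[OF this] obtain R where
    R: "sym_op R" "R o\<^sub>L R = A' o\<^sub>L A'" "\<And>x. 0 \<le> R x \<bullet> x"
    "\<And>W. W o\<^sub>L A' = A' o\<^sub>L W \<Longrightarrow> W o\<^sub>L R = R o\<^sub>L W" by blast
  show thesis
  proof (rule that[of "c *\<^sub>R R"])
    show "sym_op (c *\<^sub>R R)" by (rule sym_op_scaleR[OF R(1)])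
    show "(c *\<^sub>R R) o\<^sub>L (c *\<^sub>R R) = A o\<^sub>L A"
      by (rule compose_eqI) (simp add: AA' blinfun.bilinear_simps compose_eqD[OF R(2)])
    show "0 \<le> (c *\<^sub>R R) x \<bullet> x" for x using c R(3) by (simp add: blinfun.bilinear_simps)
    show "W o\<^sub>L (c *\<^sub>R R) = (c *\<^sub>R R) o\<^sub>L W" if W: "W o\<^sub>L A = A o\<^sub>L W" for W
    proof -
      have "W o\<^sub>L A' = A' o\<^sub>L W"
        by (rule compose_eqI) (simp add: A'_def blinfun.bilinear_simps compose_eqD[OF W])
      note com = compose_eqD[OF R(4)[OF this]]
      show ?thesis
        by (rule compose_eqI) (simp add: blinfun.bilinear_simps com)
    qed
  qed
qed

text \<open>Along \<open>x + r *\<^sub>R R x\<close> the form is a nonnegative quadratic polynomial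
  in \<open>r\<close> that vanishes at \<open>0\<close> with slope twice the squared norm of
  \<open>R x\<close>.\<close>

lemma positive_op_kernel:
  assumes R: "sym_op R" "\<And>x. 0 \<le> R x \<bullet> x" and x: "R x \<bullet> x = 0"
  shows "R x = 0"
proof -
  \<comment> \<open>The step \<open>r\<close> is negative and short enough for the linear term
    \<open>2 * r * q\<close> to dominate; the added \<open>1\<close> keeps the denominator positive
    when \<open>p = 0\<close>.\<close>
  define p q r where "p = R (R x) \<bullet> R x" and "q = R x \<bullet> R x" and "r = - q / (p + 1)"
  have p: "p \<ge> 0" using R(2) by (simp add: p_def)
  have "0 \<le> R (x + r *\<^sub>R R x) \<bullet> (x + r *\<^sub>R R x)" by (rule R(2))
  also have "\<dots> = 2 * r * q + r\<^sup>2 * p"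
    using x sym_opD[OF R(1), of "R x" x]
    by (simp add: blinfun.bilinear_simps inner_add_left inner_add_right p_def q_def
        power2_eq_square algebra_simps del: dot_square_norm)
  also have "\<dots> = - (q\<^sup>2 * (p + 2)) / (p + 1)\<^sup>2"
    using p by (simp add: r_def power2_eq_square divide_simps) (simp add: algebra_simps)
  finally have "q\<^sup>2 * (p + 2) \<le> 0" using p by (simp add: divide_le_0_iff)
  then have "q\<^sup>2 \<le> 0" using p by (smt (verit) mult_pos_pos zero_le_power2)
  then show ?thesis by (simp add: q_def)
qed

section \<open>Spectral projections of half-lines\<close>

text \<open>The inequality on the kernel is strict for nonzero vectors, which places eigenvectors
  for the eigenvalue \<open>t\<close> in the range: \<open>P\<close> belongs to the closed half-line
  \<open>{..t}\<close>.\<close>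

definition spectral_below :: "('a::real_inner \<Rightarrow>\<^sub>L 'a) \<Rightarrow> real \<Rightarrow> ('a \<Rightarrow>\<^sub>L 'a) \<Rightarrow> bool" where
  "spectral_below T t P \<longleftrightarrow> proj_op P \<and> P o\<^sub>L T = T o\<^sub>L P \<and>
     (\<forall>x. P x = x \<longrightarrow> T x \<bullet> x \<le> t * (norm x)\<^sup>2) \<and>
     (\<forall>x. P x = 0 \<longrightarrow> T x \<bullet> x \<le> t * (norm x)\<^sup>2 \<longrightarrow> x = 0)"

lemma spectral_below_exists:
  fixes T :: "'a::{real_inner,banach} \<Rightarrow>\<^sub>L 'a"
  assumes T: "sym_op T"
  shows "\<exists>P. spectral_below T t P \<and> (\<forall>W. W o\<^sub>L T = T o\<^sub>L W \<longrightarrow> W o\<^sub>L P = P o\<^sub>L W)"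
proof -
  define A where "A = T - t *\<^sub>R id_blinfun"
  have A: "sym_op A" unfolding A_def by (intro sym_op_diff sym_op_scaleR sym_op_id T)
  have Ain: "A x \<bullet> x = T x \<bullet> x - t * (norm x)\<^sup>2" for x
    by (simp add: A_def blinfun.bilinear_simps inner_diff_left power2_norm_eq_inner del: dot_square_norm)
  obtain R where R: "sym_op R" "R o\<^sub>L R = A o\<^sub>L A" "\<And>x. 0 \<le> R x \<bullet> x"
    "\<And>W. W o\<^sub>L A = A o\<^sub>L W \<Longrightarrow> W o\<^sub>L R = R o\<^sub>L W" using operator_abs[OF A] by blast
  define B where "B = R + A"
  have B: "sym_op B" unfolding B_def by (intro sym_op_add R A)
  \<comment> \<open>\<open>B\<close> is twice the positive part of \<open>A\<close>; the projection sought is the one onto its kernel.\<close>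
  define S where "S = closure (range (blinfun_apply B))"
  have "subspace (range (blinfun_apply B))"
    using linear_subspace_image[of B UNIV] by (simp add: blinfun.bounded_linear_right bounded_linear.linear subspace_UNIV)
  then have S: "subspace S" "closed S" by (auto simp: S_def subspace_closure)
  obtain Q where Q: "proj_op Q" "range (blinfun_apply Q) = S" "\<And>x z. z \<in> S \<Longrightarrow> (x - Q x) \<bullet> z = 0"
    using closed_subspace_projection[OF S] by blast
  have QS: "Q x = x \<longleftrightarrow> x \<in> S" for x
    using proj_op_idem[OF Q(1)] Q(2) by (metis rangeE rangeI)
  have orthS: "x \<bullet> z = 0" if "B x = 0" "z \<in> S" for x z
  proof -
    have "closed {z. x \<bullet> z = 0}" by (intro closed_Collect_eq continuous_intros)
    moreover have "range (blinfun_apply B) \<subseteq> {z. x \<bullet> z = 0}"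
      using that(1) sym_opD[OF B, of x] by auto
    ultimately show ?thesis using that(2) closure_minimal unfolding S_def by blast
  qed
  \<comment> \<open>By symmetry the kernel of \<open>B\<close> is the orthogonal complement of its
    range, hence of the closure \<open>S\<close>.\<close>
  have QB: "Q x = 0 \<longleftrightarrow> B x = 0" for x
  proof
    assume "Q x = 0"
    then have "x \<bullet> B (B x) = 0"
      using Q(3)[of "B (B x)" x] closure_subset unfolding S_def by (metis diff_zero rangeI subsetD)
    then show "B x = 0" using sym_opD[OF B, of x "B x"] by simp
  next
    assume "B x = 0"
    then have "x \<bullet> Q x = 0" using orthS Q(2) by blast
    then show "Q x = 0" using proj_op_inner_self[OF Q(1), of x] by (simp add: inner_commute)
  qed
  have RA: "R (A x) = A (R x)" for x using compose_eqD[OF R(4)[of A]] by simp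
  \<comment> \<open>Since \<open>R\<close> and \<open>A\<close> commute,
    \<open>(R - A) (R + A) = R\<^sup>2 - A\<^sup>2 = 0\<close>; so \<open>R = A\<close> on the range
    of \<open>B\<close>, and on \<open>S\<close> by continuity.\<close>
  have onS: "R x = A x" if "x \<in> S" for x
  proof -
    have "closed {x. R x = A x}" by (intro closed_Collect_eq continuous_intros)
    moreover have "range (blinfun_apply B) \<subseteq> {x. R x = A x}"
      using compose_eqD[OF R(2)] by (auto simp: B_def blinfun.bilinear_simps RA)
    ultimately show ?thesis using that closure_minimal unfolding S_def by blast
  qed
  define P where "P = id_blinfun - Q"
  have Papp: "P x = x - Q x" for x by (simp add: P_def blinfun.bilinear_simps)
  have com: "W o\<^sub>L P = P o\<^sub>L W" if W: "W o\<^sub>L T = T o\<^sub>L W" for W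
  proof (rule compose_eqI)
    fix x
    have "W o\<^sub>L A = A o\<^sub>L W"
      by (rule compose_eqI) (simp add: A_def blinfun.bilinear_simps compose_eqD[OF W])
    note WA = compose_eqD[OF this] and WR = compose_eqD[OF R(4)[OF this]]
    have WB: "W (B z) = B (W z)" for z
      by (simp add: B_def blinfun.bilinear_simps WA WR)
    \<comment> \<open>As \<open>W\<close> commutes with \<open>B\<close>, it preserves both
      \<open>S\<close> and the kernel of \<open>B\<close>. Preserving these two complements means
      commuting with \<open>P\<close>.\<close>
    have "W z \<in> S" if "z \<in> S" for z
    proof -
      have "closed {z. W z \<in> S}"
        using continuous_closed_vimage[OF S(2), of W] by (auto simp: vimage_def continuous_intros)
      moreover have "range (blinfun_apply B) \<subseteq> {z. W z \<in> S}"
        using closure_subset[of "range (blinfun_apply B)"] by (auto simp: WB S_def)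
      ultimately show ?thesis using that closure_minimal unfolding S_def by blast
    qed
    then have 1: "Q (W (Q x)) = W (Q x)" using Q(2) QS by blast
    have "Q (x - Q x) = 0" by (simp add: blinfun.bilinear_simps proj_op_idem[OF Q(1)])
    then have "Q (W (x - Q x)) = 0" by (simp add: QB flip: WB)
    with 1 show "W (P x) = P (W x)" by (simp add: Papp blinfun.bilinear_simps)
  qed
  have "T x \<bullet> x \<le> t * (norm x)\<^sup>2" if "P x = x" for x
  proof -
    have "R x = - A x" using that QB[of x] by (simp add: Papp B_def blinfun.bilinear_simps eq_neg_iff_add_eq_0)
    then show ?thesis using R(3)[of x] Ain[of x] by simp
  qed
  moreover have "x = 0" if "P x = 0" "T x \<bullet> x \<le> t * (norm x)\<^sup>2" for x
  proof -
    have xS: "x \<in> S" using that(1) QS[of x] by (simp add: Papp)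
    \<comment> \<open>On \<open>S\<close> the form of \<open>A\<close> is that of \<open>R\<close>,
      hence nonnegative, so the assumed upper bound makes it zero. Then \<open>x\<close> lies in
      \<open>S\<close> and in its orthogonal complement.\<close>
    have "R x \<bullet> x = 0" using onS[OF xS] that(2) Ain[of x] R(3)[of x] by simp
    then have "R x = 0" by (rule positive_op_kernel[OF R(1,3)])
    then have "B x = 0" using onS[OF xS] by (simp add: B_def blinfun.bilinear_simps)
    from orthS[OF this xS] show ?thesis by simp
  qed
  moreover have "proj_op P" unfolding P_def by (rule proj_op_complement[OF Q(1)])
  ultimately have "spectral_below T t P"
    using com[of T] by (simp add: spectral_below_def)
  with com show ?thesis by blast
qed

text \<open>The part \<open>v\<close> of \<open>P x\<close> outside the range of \<open>Q\<close>
  still lies in the range of \<open>P\<close>, as the projections commute. There the form is at most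
  \<open>s\<close>, hence at most \<open>t\<close>, and the kernel condition on \<open>Q\<close>
  excludes this unless \<open>v = 0\<close>.\<close>

lemma spectral_below_mono:
  assumes P: "spectral_below T s P" and Q: "spectral_below T t Q" and PQ: "P o\<^sub>L Q = Q o\<^sub>L P"
    and st: "s \<le> t"
  shows "Q (P x) = P x"
proof -
  define v where "v = P x - Q (P x)"
  have "P v = v" "Q v = 0"
    using P Q compose_eqD[OF PQ] by (auto simp: v_def spectral_below_def blinfun.bilinear_simps proj_op_idem)
  moreover from this have "T v \<bullet> v \<le> t * (norm v)\<^sup>2"
    using P mult_right_mono[OF st zero_le_power2[of "norm v"]] unfolding spectral_below_def by fastforce
  ultimately have "v = 0" using Q unfolding spectral_below_def by blast
  then show ?thesis by (simp add: v_def)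
qed

text \<open>Monotonicity in both directions with equal thresholds gives \<open>Q P = P\<close> and
  \<open>P Q = Q\<close>.\<close>

lemma spectral_below_unique:
  assumes P: "spectral_below T t P" and Q: "spectral_below T t Q" and PQ: "P o\<^sub>L Q = Q o\<^sub>L P"
  shows "P = Q"
  using spectral_below_mono[OF P Q PQ] spectral_below_mono[OF Q P PQ[symmetric]] compose_eqD[OF PQ]
  by (metis blinfun_eqI order_refl)

section \<open>Projection-valued measures on the real line\<close>

text \<open>At the vector \<open>P x\<close> the first summand already exhausts the bound.\<close>

lemma proj_op_disjoint:
  assumes "proj_op P" "proj_op Q" "\<And>x. (norm (P x))\<^sup>2 + (norm (Q x))\<^sup>2 \<le> (norm x)\<^sup>2"
  shows "Q (P x) = 0"
  using assms(3)[of "P x"] by (simp add: proj_op_idem[OF assms(1)])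

lemma norm_sum_orthogonal:
  fixes v :: "'i \<Rightarrow> 'a::real_inner"
  assumes "finite I" "\<And>i j. i \<in> I \<Longrightarrow> j \<in> I \<Longrightarrow> i \<noteq> j \<Longrightarrow> v i \<bullet> v j = 0"
  shows "(norm (\<Sum>i\<in>I. v i))\<^sup>2 = (\<Sum>i\<in>I. (norm (v i))\<^sup>2)"
proof -
  have "(norm (\<Sum>i\<in>I. v i))\<^sup>2 = (\<Sum>i\<in>I. \<Sum>j\<in>I. v i \<bullet> v j)"
    unfolding power2_norm_eq_inner inner_sum_left inner_sum_right by (rule sum.swap)
  also have "\<dots> = (\<Sum>i\<in>I. \<Sum>j\<in>I. if j = i then (norm (v i))\<^sup>2 else 0)"
    using assms(2) by (intro sum.cong refl) (auto simp: dot_square_norm)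
  also have "\<dots> = (\<Sum>i\<in>I. (norm (v i))\<^sup>2)" using assms(1) by simp
  finally show ?thesis .
qed

text \<open>Bessel's inequality makes the squared norms summable, and by Pythagoras the series of
  vectors is then Cauchy.\<close>

lemma orthogonal_projections_sums:
  fixes P :: "nat \<Rightarrow> 'a::{real_inner,banach} \<Rightarrow>\<^sub>L 'a"
  assumes P: "\<And>i. proj_op (P i)" and disj: "\<And>i j x. i \<noteq> j \<Longrightarrow> P i (P j x) = 0"
  shows "\<exists>Q. proj_op Q \<and> (\<forall>x. (\<lambda>i. P i x) sums Q x)"
proof -
  have orth: "P i x \<bullet> P j x = 0" if "i \<noteq> j" for i j x
    using disj[OF that, of x] proj_op_inner[OF P, of i x "P j x"] by simp
  have nsum: "(norm (\<Sum>i\<in>I. P i x))\<^sup>2 = (\<Sum>i\<in>I. (norm (P i x))\<^sup>2)" if "finite I" for I x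
    using that orth by (rule norm_sum_orthogonal)
  have bound: "norm (\<Sum>i\<in>I. P i x) \<le> norm x" if I: "finite I" for I x
  proof -
    have "(norm (\<Sum>i\<in>I. P i x))\<^sup>2 = (\<Sum>i\<in>I. P i x) \<bullet> x"
      by (simp add: nsum[OF I] inner_sum_left proj_op_inner_self[OF P])
    also have "\<dots> \<le> norm (\<Sum>i\<in>I. P i x) * norm x" by (rule norm_cauchy_schwarz)
    finally show ?thesis
      by (cases "norm (\<Sum>i\<in>I. P i x) = 0") (simp_all add: power2_eq_square)
  qed
  have "summable (\<lambda>i. (norm (P i x))\<^sup>2)" for x
  proof (rule summableI_nonneg_bounded)
    show "(\<Sum>i<n. (norm (P i x))\<^sup>2) \<le> (norm x)\<^sup>2" for n
      using power_mono[OF bound[OF finite_lessThan[of n], of x] norm_ge_zero, of 2]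
        nsum[OF finite_lessThan[of n], of x] by simp
  qed simp
  have sm: "summable (\<lambda>i. P i x)" for x
    unfolding summable_Cauchy
  proof (intro allI impI)
    fix e :: real assume e: "e > 0"
    with \<open>summable (\<lambda>i. (norm (P i x))\<^sup>2)\<close> obtain N where
      N: "\<And>m n. m \<ge> N \<Longrightarrow> norm (\<Sum>i=m..<n. (norm (P i x))\<^sup>2) < e\<^sup>2"
      unfolding summable_Cauchy by (metis zero_less_power)
    have "norm (\<Sum>i=m..<n. P i x) < e" if "m \<ge> N" for m n
      using N[OF that, of n] e nsum[of "{m..<n}" x] power2_less_imp_less[of "norm (\<Sum>i=m..<n. P i x)" e]
      by simp
    then show "\<exists>N. \<forall>m\<ge>N. \<forall>n. norm (\<Sum>i=m..<n. P i x) < e" by blast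
  qed
  define q where "q = (\<lambda>x. \<Sum>i. P i x)"
  have q: "(\<lambda>i. P i x) sums q x" for x using sm by (simp add: q_def summable_sums)
  have "norm (q x) \<le> norm x * 1" for x
    using bound q[of x] unfolding sums_def
    by (intro LIMSEQ_le_const2[OF tendsto_norm]) auto
  moreover have "linear q"
  proof (rule linearI)
    show "q (x + y) = q x + q y" for x y
      using sums_add[OF q[of x] q[of y]] q[of "x + y"]
      by (intro sums_unique2[of "\<lambda>i. P i (x + y)"]) (auto simp: blinfun.add_right)
    show "q (c *\<^sub>R x) = c *\<^sub>R q x" for c x
      using sums_scaleR_right[OF q[of x], of c] q[of "c *\<^sub>R x"]
      by (intro sums_unique2[of "\<lambda>i. P i (c *\<^sub>R x)"]) (auto simp: blinfun.scaleR_right)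
  qed
  ultimately have "bounded_linear q"
    unfolding bounded_linear_def bounded_linear_axioms_def by blast
  then have app: "blinfun_apply (Blinfun q) = q" by (rule bounded_linear_Blinfun_apply)
  have "q x \<bullet> y = x \<bullet> q y" for x y
  proof -
    have "(\<lambda>i. P i x \<bullet> y) sums (q x \<bullet> y)" "(\<lambda>i. x \<bullet> P i y) sums (x \<bullet> q y)"
      by (intro bounded_linear.sums[OF bounded_linear_inner_left q]
          bounded_linear.sums[OF bounded_linear_inner_right q])+
    then show ?thesis using sums_unique2 by (simp add: proj_op_inner[OF P]) blast
  qed
  moreover have "q (q x) = q x" for x
  proof -
    \<comment> \<open>Each projection keeps only its own term of the series, so summing a second
      time changes nothing: \<open>q\<close> is idempotent.\<close>
    have "P i (q x) = P i x" for i
    proof -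
      have "(\<lambda>j. P i (P j x)) sums P i (q x)"
        by (rule bounded_linear.sums[OF blinfun.bounded_linear_right q])
      moreover have "(\<lambda>j. P i (P j x)) = (\<lambda>j. if j = i then P i x else 0)"
        using disj proj_op_idem[OF P] by auto
      ultimately show ?thesis using sums_single[of i "\<lambda>_. P i x"] sums_unique2 by metis
    qed
    then show ?thesis by (simp add: q_def)
  qed
  ultimately have "proj_op (Blinfun q)"
    by (auto simp: proj_op_def sym_op_def app intro!: blinfun_eqI)
  with q show ?thesis by (intro exI[of _ "Blinfun q"]) (simp add: app)
qed

section \<open>The resolution of the identity\<close>

locale symmetric_operator =
  fixes T :: "'a::{real_inner,banach} \<Rightarrow>\<^sub>L 'a"
  assumes sym: "sym_op T"
begin

text \<open>The choice is forced: each candidate commutes with \<open>T\<close>, so any two commute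
  with each other and \<open>spectral_below_unique\<close> applies. Commuting with the whole
  commutant of \<open>T\<close> later yields right linearity.\<close>

definition resolution :: "real \<Rightarrow> 'a \<Rightarrow>\<^sub>L 'a" where
  "resolution t = (SOME P. spectral_below T t P \<and> (\<forall>W. W o\<^sub>L T = T o\<^sub>L W \<longrightarrow> W o\<^sub>L P = P o\<^sub>L W))"

lemma resolution:
  shows resolution_below: "spectral_below T t (resolution t)"
    and resolution_commute: "W o\<^sub>L T = T o\<^sub>L W \<Longrightarrow> W o\<^sub>L resolution t = resolution t o\<^sub>L W"
  using someI_ex[OF spectral_below_exists[OF sym, of t]] unfolding resolution_def by blast+

lemma resolution_proj: "proj_op (resolution t)"
  using resolution_below spectral_below_def by blast

lemma resolution_comm: "resolution s o\<^sub>L resolution t = resolution t o\<^sub>L resolution s"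
  using resolution_below[of s] by (intro resolution_commute) (simp add: spectral_below_def)

lemma resolution_mono:
  assumes "s \<le> t"
  shows "resolution t (resolution s x) = resolution s x" "resolution s (resolution t x) = resolution s x"
  using spectral_below_mono[OF resolution_below resolution_below resolution_comm assms]
  by (simp_all add: compose_eqD[OF resolution_comm[of s t]])

lemma resolution_norm_mono:
  assumes "s \<le> t"
  shows "(norm (resolution s x))\<^sup>2 \<le> (norm (resolution t x))\<^sup>2"
  using proj_op_norm_le[OF resolution_proj, of s "resolution t x"]
  by (simp add: resolution_mono[OF assms] power_mono)

lemma inner_bound: "\<bar>T x \<bullet> x\<bar> \<le> norm T * (norm x)\<^sup>2"
proof -
  have "\<bar>T x \<bullet> x\<bar> \<le> norm (T x) * norm x" by (rule Cauchy_Schwarz_ineq2)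
  also have "\<dots> \<le> norm T * norm x * norm x"
    by (intro mult_right_mono norm_blinfun) simp
  finally show ?thesis by (simp add: power2_eq_square)
qed

text \<open>The form of \<open>T\<close> never drops below \<open>- norm T\<close>. The bound on
  \<open>t\<close> is strict here, and weak in \<open>resolution_high\<close>, because an eigenvalue
  equal to \<open>t\<close> counts for the range.\<close>

lemma resolution_low:
  assumes t: "t < - norm T"
  shows "resolution t x = 0"
proof -
  define v where "v = resolution t x"
  have "resolution t v = v" by (simp add: v_def proj_op_idem[OF resolution_proj])
  then have "T v \<bullet> v \<le> t * (norm v)\<^sup>2" using resolution_below spectral_below_def by blast
  then have "0 \<le> (t + norm T) * (norm v)\<^sup>2" using inner_bound[of v] by (simp add: algebra_simps)
  with t show ?thesis by (simp add: zero_le_mult_iff flip: v_def)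
qed

lemma resolution_high:
  assumes t: "t \<ge> norm T"
  shows "resolution t x = x"
proof -
  define v where "v = x - resolution t x"
  have "resolution t v = 0" by (simp add: v_def blinfun.bilinear_simps proj_op_idem[OF resolution_proj])
  moreover have "T v \<bullet> v \<le> t * (norm v)\<^sup>2"
    using inner_bound[of v] mult_right_mono[OF t zero_le_power2[of "norm v"]] by linarith
  ultimately have "v = 0" using resolution_below spectral_below_def by blast
  then show ?thesis by (simp add: v_def)
qed

text \<open>The vectors converge because the projections decrease. The limit \<open>y\<close> lies
  in every range beyond \<open>t\<close>, so the form on \<open>y - resolution t y\<close> is at
  most \<open>t\<close>, while this vector lies in the kernel of
  \<open>resolution t\<close>.\<close>

lemma resolution_right_limit: "(\<lambda>n. resolution (t + 1 / real (Suc n)) x) \<longlonglongrightarrow> resolution t x"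
proof -
  define s where "s n = t + 1 / real (Suc n)" for n
  define e where "e n = resolution (s n) x" for n
  have s: "s \<longlonglongrightarrow> t" "\<And>n. t < s n" "decseq s"
    using tendsto_add[OF tendsto_const LIMSEQ_Suc[OF lim_1_over_n], of t]
    by (auto simp: s_def[abs_def] decseq_def frac_le simp del: of_nat_Suc)
  \<comment> \<open>Pythagoras for the smaller projection applied to \<open>e m\<close>. The Cauchy
    property of the vectors thus follows from that of a monotone bounded real sequence.\<close>
  have diff: "(norm (e m - e n))\<^sup>2 = (norm (e m))\<^sup>2 - (norm (e n))\<^sup>2" if "m \<le> n" for m n
    using proj_op_pythagoras[OF resolution_proj, of "e m" "s n"] resolution_mono(2)[of "s n" "s m" x]
      decseqD[OF s(3) that] by (simp add: e_def)
  have "decseq (\<lambda>n. (norm (e n))\<^sup>2)"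
    using decseqD[OF s(3)] unfolding decseq_def e_def by (blast intro: resolution_norm_mono)
  then have "convergent (\<lambda>n. (norm (e n))\<^sup>2)"
    by (intro Bseq_monoseq_convergent BseqI'[of _ "(norm x)\<^sup>2"])
      (auto simp: monoseq_iff e_def intro!: power_mono proj_op_norm_le resolution_proj)
  then have C: "Cauchy (\<lambda>n. (norm (e n))\<^sup>2)" by (rule convergent_Cauchy)
  have "Cauchy e"
  proof (rule metric_CauchyI)
    fix r :: real assume r: "r > 0"
    obtain N where N: "\<And>m n. m \<ge> N \<Longrightarrow> n \<ge> N \<Longrightarrow> dist ((norm (e m))\<^sup>2) ((norm (e n))\<^sup>2) < r\<^sup>2"
      using metric_CauchyD[OF C, of "r\<^sup>2"] r by auto
    have *: "dist (e m) (e n) < r" if "m \<ge> N" "n \<ge> N" "m \<le> n" for m n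
      using N[OF that(1,2)] diff[OF that(3)] r power2_less_imp_less[of "norm (e m - e n)" r]
      by (simp add: dist_norm)
    have "dist (e m) (e n) < r" if "m \<ge> N" "n \<ge> N" for m n
      using *[of m n] *[of n m] that by (cases "m \<le> n") (auto simp: dist_commute)
    then show "\<exists>M. \<forall>m\<ge>M. \<forall>n\<ge>M. dist (e m) (e n) < r" by blast
  qed
  then obtain y where y: "e \<longlonglongrightarrow> y" using Cauchy_convergent convergent_def by blast
  have fix_y: "resolution r y = y" if "r > t" for r
  proof -
    have "(\<lambda>n. resolution r (e n)) \<longlonglongrightarrow> resolution r y" by (intro tendsto_intros y)
    moreover have "\<forall>\<^sub>F n in sequentially. resolution r (e n) = e n"
      using order_tendstoD(2)[OF s(1) that]
      by eventually_elim (simp add: e_def resolution_mono)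
    ultimately have "e \<longlonglongrightarrow> resolution r y" using Lim_transform_eventually by blast
    then show ?thesis using y LIMSEQ_unique by blast
  qed
  define v where "v = y - resolution t y"
  have "T v \<bullet> v \<le> r * (norm v)\<^sup>2" if "r > t" for r
  proof -
    have "resolution r v = v"
      using that fix_y[OF that] by (simp add: v_def blinfun.bilinear_simps resolution_mono)
    then show ?thesis using resolution_below spectral_below_def by blast
  qed
  then have "T v \<bullet> v \<le> s n * (norm v)\<^sup>2" for n using s(2) by blast
  then have "T v \<bullet> v \<le> t * (norm v)\<^sup>2"
    by (intro LIMSEQ_le_const[OF tendsto_mult_right[OF s(1)]]) auto
  moreover have "resolution t v = 0"
    by (simp add: v_def blinfun.bilinear_simps proj_op_idem[OF resolution_proj])
  ultimately have "v = 0" using resolution_below spectral_below_def by blast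
  then have "y = resolution t y" by (simp add: v_def)
  also have "\<dots> = resolution t x"
  proof -
    have "(\<lambda>n. resolution t (e n)) \<longlonglongrightarrow> resolution t y" by (intro tendsto_intros y)
    moreover have "resolution t (e n) = resolution t x" for n
      using s(2)[of n] by (simp add: e_def resolution_mono)
    ultimately have "(\<lambda>n. resolution t x) \<longlonglongrightarrow> resolution t y" by simp
    then show ?thesis using LIMSEQ_unique[OF _ tendsto_const] by blast
  qed
  finally have yx: "y = resolution t x" .
  show ?thesis using y unfolding yx e_def s_def .
qed

text \<open>Monotonicity reduces the one-sided limit to a limit along a single sequence.\<close>

lemma resolution_right_continuous: "continuous (at_right t) (\<lambda>s. (norm (resolution s x))\<^sup>2)"
  unfolding continuous_within
proof (rule order_tendstoI)
  let ?g = "\<lambda>s. (norm (resolution s x))\<^sup>2"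
  fix a assume "a < ?g t"
  then show "\<forall>\<^sub>F s in at_right t. a < ?g s"
    by (intro eventually_at_rightI[of t "t + 1"]) (auto intro: less_le_trans resolution_norm_mono less_imp_le)
next
  let ?g = "\<lambda>s. (norm (resolution s x))\<^sup>2"
  fix a assume a: "?g t < a"
  have "(\<lambda>n. ?g (t + 1 / real (Suc n))) \<longlonglongrightarrow> ?g t" by (intro tendsto_intros resolution_right_limit)
  from eventually_happens'[OF _ order_tendstoD(2)[OF this a]]
  obtain n where "?g (t + 1 / real (Suc n)) < a" by auto
  then show "\<forall>\<^sub>F s in at_right t. ?g s < a"
    by (intro eventually_at_rightI[of t "t + 1 / real (Suc n)"])
      (auto intro: le_less_trans resolution_norm_mono less_imp_le)
qed

section \<open>Scalar spectral measures\<close>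

text \<open>A Lebesgue-Stieltjes measure. It is the form
  \<open>M \<mapsto> E(M) x \<bullet> x\<close> of the spectral measure, available before the
  projections \<open>E(M)\<close> are.\<close>

definition spectral_dist :: "'a \<Rightarrow> real measure" where
  "spectral_dist x = interval_measure (\<lambda>t. (norm (resolution t x))\<^sup>2)"

lemma sets_spectral_dist [simp]: "sets (spectral_dist x) = sets borel"
  by (simp add: spectral_dist_def)

lemma resolution_norm_at_bot: "((\<lambda>t. (norm (resolution t x))\<^sup>2) \<longlongrightarrow> 0) at_bot"
  by (rule tendsto_eventually)
    (auto simp: resolution_low eventually_at_bot_dense intro!: exI[of _ "- norm T"])

lemma resolution_norm_at_top: "((\<lambda>t. (norm (resolution t x))\<^sup>2) \<longlongrightarrow> (norm x)\<^sup>2) at_top"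
  by (rule tendsto_eventually)
    (auto simp: resolution_high eventually_at_top_linorder intro!: exI[of _ "norm T"])

lemma finite_spectral_dist: "finite_measure (spectral_dist x)"
proof -
  interpret finite_borel_measure "spectral_dist x"
    unfolding spectral_dist_def
    by (rule finite_borel_measure_interval_measure[OF resolution_norm_mono
          resolution_right_continuous resolution_norm_at_bot resolution_norm_at_top]) simp_all
  show ?thesis by unfold_locales
qed

lemma measure_spectral_dist_UNIV: "measure (spectral_dist x) UNIV = (norm x)\<^sup>2"
  using interval_measure_UNIV[OF resolution_norm_mono
      resolution_right_continuous resolution_norm_at_bot resolution_norm_at_top, of x]
  by (simp add: spectral_dist_def measure_def)

lemma measure_spectral_dist_atMost: "measure (spectral_dist x) {..t} = (norm (resolution t x))\<^sup>2"
  unfolding spectral_dist_def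
  by (rule measure_interval_measure_Iic[OF resolution_norm_mono resolution_right_continuous
        resolution_norm_at_bot])

section \<open>From half-lines to Borel sets\<close>

definition spectral_proj :: "real set \<Rightarrow> 'a \<Rightarrow>\<^sub>L 'a \<Rightarrow> bool" where
  "spectral_proj M P \<longleftrightarrow> proj_op P \<and> (\<forall>x. (norm (P x))\<^sup>2 = measure (spectral_dist x) M) \<and>
     (\<forall>W. W o\<^sub>L T = T o\<^sub>L W \<longrightarrow> W o\<^sub>L P = P o\<^sub>L W)"

text \<open>Disjoint sets have measures adding up to at most the total mass
  \<open>(norm x)\<^sup>2\<close>, which is the criterion of
  \<open>proj_op_disjoint\<close>.\<close>

lemma spectral_proj_disjoint:
  assumes "spectral_proj M P" "spectral_proj N Q" "M \<inter> N = {}" "M \<in> sets borel" "N \<in> sets borel"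
  shows "Q (P x) = 0"
proof (rule proj_op_disjoint)
  show "proj_op P" "proj_op Q" using assms by (auto simp: spectral_proj_def)
  fix x
  interpret finite_measure "spectral_dist x" by (rule finite_spectral_dist)
  have "(norm (P x))\<^sup>2 + (norm (Q x))\<^sup>2 = measure (spectral_dist x) (M \<union> N)"
    using assms by (simp add: spectral_proj_def finite_measure_Union)
  also have "\<dots> \<le> measure (spectral_dist x) UNIV"
    using assms by (intro finite_measure_mono) auto
  finally show "(norm (P x))\<^sup>2 + (norm (Q x))\<^sup>2 \<le> (norm x)\<^sup>2"
    by (simp add: measure_spectral_dist_UNIV)
qed

text \<open>The squared norms are quadratic forms, so they pass through the strong sum and match the
  countable additivity of the scalar measures.\<close>

lemma spectral_proj_UN:
  assumes A: "disjoint_family A" "range A \<subseteq> sets borel" and P: "\<And>i::nat. spectral_proj (A i) (P i)"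
  shows "\<exists>Q. spectral_proj (\<Union>i. A i) Q \<and> (\<forall>x. (\<lambda>i. P i x) sums Q x)"
proof -
  have pr: "proj_op (P i)" for i using P spectral_proj_def by blast
  have disj: "P i (P j x) = 0" if "i \<noteq> j" for i j x
    using A that by (intro spectral_proj_disjoint[OF P[of j] P[of i]]) (auto simp: disjoint_family_on_def)
  obtain Q where Q: "proj_op Q" "\<And>x. (\<lambda>i. P i x) sums Q x"
    using orthogonal_projections_sums[of P, OF pr disj] by blast
  have "(norm (Q x))\<^sup>2 = measure (spectral_dist x) (\<Union>i. A i)" for x
  proof -
    interpret finite_measure "spectral_dist x" by (rule finite_spectral_dist)
    have "(\<lambda>i. P i x \<bullet> x) sums (Q x \<bullet> x)"
      by (rule bounded_linear.sums[OF bounded_linear_inner_left Q(2)])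
    then have "(\<lambda>i. measure (spectral_dist x) (A i)) sums (norm (Q x))\<^sup>2"
      using P by (simp add: proj_op_inner_self[OF pr] proj_op_inner_self[OF Q(1)] spectral_proj_def)
    moreover have "(\<lambda>i. measure (spectral_dist x) (A i)) sums measure (spectral_dist x) (\<Union>i. A i)"
      using A by (intro finite_measure_UNION) auto
    ultimately show ?thesis by (rule sums_unique2)
  qed
  moreover have "W o\<^sub>L Q = Q o\<^sub>L W" if W: "W o\<^sub>L T = T o\<^sub>L W" for W
  proof (rule compose_eqI)
    fix x
    have "W o\<^sub>L P i = P i o\<^sub>L W" for i using P W by (simp add: spectral_proj_def)
    from compose_eqD[OF this] have "(\<lambda>i. P i (W x)) = (\<lambda>i. W (P i x))" by simp
    moreover have "(\<lambda>i. W (P i x)) sums W (Q x)"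
      by (rule bounded_linear.sums[OF blinfun.bounded_linear_right Q(2)])
    ultimately show "W (Q x) = Q (W x)" using Q(2)[of "W x"] sums_unique2 by metis
  qed
  ultimately show ?thesis using Q unfolding spectral_proj_def by blast
qed

text \<open>Half-lines are stable under intersection and generate the Borel sets. Complements are
  served by \<open>id_blinfun - P\<close>, disjoint unions by strong sums.\<close>

lemma spectral_proj_exists:
  assumes "M \<in> sets borel"
  shows "\<exists>P. spectral_proj M P"
proof -
  have bor: "sets borel = sigma_sets UNIV (range (\<lambda>a::real. {..a}))"
    using arg_cong[OF borel_eq_atMost, of sets] by simp
  have "Int_stable (range (\<lambda>a::real. {..a}))"
    by (auto simp: Int_stable_def)
  moreover have "range (\<lambda>a::real. {..a}) \<subseteq> Pow UNIV" by simp
  moreover have "M \<in> sigma_sets UNIV (range (\<lambda>a::real. {..a}))" using assms bor by simp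
  ultimately show ?thesis
  proof (induction rule: sigma_sets_induct_disjoint)
    case (basic A)
    then obtain t where "A = {..t}" by blast
    then have "spectral_proj A (resolution t)"
      by (simp add: spectral_proj_def resolution_proj measure_spectral_dist_atMost resolution_commute)
    then show ?case ..
  next
    case empty
    have "spectral_proj {} 0" by (simp add: spectral_proj_def proj_op_0)
    then show ?case ..
  next
    case (compl A)
    then obtain P where P: "spectral_proj A P" by blast
    then have pr: "proj_op P" by (simp add: spectral_proj_def)
    have "(norm ((id_blinfun - P) x))\<^sup>2 = measure (spectral_dist x) (UNIV - A)" for x
    proof -
      interpret finite_measure "spectral_dist x" by (rule finite_spectral_dist)
      have "A \<in> sets (spectral_dist x)" using compl bor by simp
      from finite_measure_compl[OF this] show ?thesis
        using proj_op_pythagoras[OF pr, of x] P measure_spectral_dist_UNIV[of x] sets_eq_imp_space_eq[OF sets_spectral_dist[of x]]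
        by (simp add: spectral_proj_def blinfun.bilinear_simps)
    qed
    moreover have "W o\<^sub>L (id_blinfun - P) = (id_blinfun - P) o\<^sub>L W" if W: "W o\<^sub>L T = T o\<^sub>L W" for W
    proof -
      have "W o\<^sub>L P = P o\<^sub>L W" using P W by (simp add: spectral_proj_def)
      from compose_eqD[OF this] show ?thesis by (intro compose_eqI) (simp add: blinfun.bilinear_simps)
    qed
    ultimately have "spectral_proj (UNIV - A) (id_blinfun - P)"
      by (simp add: spectral_proj_def proj_op_complement[OF pr])
    then show ?case ..
  next
    case (union A)
    then obtain P where "\<And>i. spectral_proj (A i) (P i)" by metis
    moreover have "range A \<subseteq> sets borel" using union bor by simp
    ultimately show ?case using spectral_proj_UN[of A P, OF union(1)] by blast
  qed
qed

definition spectral_set_proj :: "real set \<Rightarrow> 'a \<Rightarrow>\<^sub>L 'a" where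
  "spectral_set_proj M = (SOME P. spectral_proj M P)"

lemma spectral_proj_unique: "spectral_proj M P \<Longrightarrow> spectral_proj M Q \<Longrightarrow> P = Q"
  by (rule proj_op_eqI) (auto simp: spectral_proj_def intro: power2_eq_imp_eq)

lemma spectral_set_proj: "M \<in> sets borel \<Longrightarrow> spectral_proj M (spectral_set_proj M)"
  unfolding spectral_set_proj_def using someI_ex[OF spectral_proj_exists] .

lemma spectral_set_proj_atMost: "spectral_set_proj {..t} = resolution t"
  by (rule spectral_proj_unique[OF spectral_set_proj])
    (simp_all add: spectral_proj_def resolution_proj measure_spectral_dist_atMost resolution_commute)

lemma spectral_set_proj_UNIV: "spectral_set_proj UNIV = id_blinfun"
  by (rule spectral_proj_unique[OF spectral_set_proj])
    (simp_all add: spectral_proj_def proj_op_id measure_spectral_dist_UNIV blinfun_eqI)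

lemma spectral_set_proj_sums:
  assumes A: "disjoint_family A" "range A \<subseteq> sets borel"
  shows "(\<lambda>i::nat. spectral_set_proj (A i) x) sums spectral_set_proj (\<Union>i. A i) x"
proof -
  have "spectral_proj (A i) (spectral_set_proj (A i))" for i
    using A(2) by (intro spectral_set_proj) auto
  from spectral_proj_UN[of A "\<lambda>i. spectral_set_proj (A i)", OF A this] obtain Q where
    Q: "spectral_proj (\<Union>i. A i) Q" "\<And>x. (\<lambda>i. spectral_set_proj (A i) x) sums Q x" by blast
  have "(\<Union>i. A i) \<in> sets borel" using A(2) by auto
  from spectral_proj_unique[OF spectral_set_proj[OF this] Q(1)] Q(2) show ?thesis by simp
qed

end

section \<open>Clifford operators as real operators\<close>

lemma self_adjoint_sym_op: "self_adjoint T \<Longrightarrow> sym_op T"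
  unfolding self_adjoint_def sym_op_def by (metis cl_Re_inner)

text \<open>Only equal index sets contribute to the scalar part, so this product extracts one
  coefficient up to sign.\<close>

lemma cl_Re_mult_basis: "cl_Re (cl_mult c (cl_basis D)) = cl_sign D D * c $ D"
proof -
  have "cl_Re (cl_mult c (cl_basis D)) =
    (\<Sum>A\<in>UNIV. \<Sum>B\<in>UNIV. if B = D then (if A = D then cl_sign D D * c $ D else 0) else 0)"
    unfolding cl_Re_def cl_mult_def sum_component
    by (intro sum.cong refl) (auto simp: cl_basis_nth)
  then show ?thesis by simp
qed

lemma cl_eqI:
  assumes "\<And>a. cl_Re (cl_mult c a) = cl_Re (cl_mult d a)"
  shows "c = d"
proof -
  have "c $ D = d $ D" for D
  proof -
    have "cl_sign D D * (cl_sign D D * c $ D) = cl_sign D D * (cl_sign D D * d $ D)"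
      using assms[of "cl_basis D"] by (simp add: cl_Re_mult_basis)
    then show ?thesis by (simp add: mult.assoc[symmetric])
  qed
  then show ?thesis by (simp add: vec_eq_iff)
qed

text \<open>A Clifford number is determined by the real parts of its right multiples. Right
  linearity moves the multiplier inside the inner product, where real symmetry applies.\<close>

lemma sym_op_self_adjoint:
  assumes "right_linear T" "sym_op T"
  shows "self_adjoint T"
  unfolding self_adjoint_def
proof (intro allI cl_eqI)
  fix x y a
  have "cl_Re (cl_mult (cl_inner (T x) y) a) = T (cl_right x a) \<bullet> y"
    using assms(1) by (simp add: right_linear_def cl_Re_inner flip: cl_inner_right)
  also have "\<dots> = cl_right x a \<bullet> T y" by (rule sym_opD[OF assms(2)])
  also have "\<dots> = cl_Re (cl_mult (cl_inner x (T y)) a)"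
    by (simp add: cl_Re_inner flip: cl_inner_right)
  finally show "cl_Re (cl_mult (cl_inner (T x) y) a) = cl_Re (cl_mult (cl_inner x (T y)) a)" .
qed

lemma orth_projection_proj_op: "orth_projection P \<Longrightarrow> proj_op P"
  by (simp add: orth_projection_def proj_op_def self_adjoint_sym_op)

lemma orth_projectionI: "right_linear P \<Longrightarrow> proj_op P \<Longrightarrow> orth_projection P"
  by (simp add: orth_projection_def proj_op_def sym_op_self_adjoint)

lemma bounded_linear_axis: "bounded_linear (axis i :: 'a::real_normed_vector \<Rightarrow> 'a ^ 'n)"
proof (rule bounded_linear_intro[where K = 1])
  show "axis i (x + y) = axis i x + axis i y" "axis i (r *\<^sub>R x) = r *\<^sub>R axis i x"
    for x y :: 'a and r
    by (auto simp: axis_def vec_eq_iff)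
  show "norm (axis i x :: 'a ^ 'n) \<le> norm x * 1" for x :: 'a
  proof -
    have "(\<Sum>j\<in>UNIV. (norm ((axis i x :: 'a ^ 'n) $ j))\<^sup>2) = (\<Sum>j\<in>UNIV. if j = i then (norm x)\<^sup>2 else 0)"
      by (intro sum.cong) (auto simp: axis_def)
    then show ?thesis by (simp add: norm_vec_def L2_set_def)
  qed
qed

lemma bounded_linear_cl_right: "bounded_linear (\<lambda>x. cl_right x a)"
  unfolding cl_right_def
  by (intro bounded_linear_sum bounded_linear_compose[OF bounded_linear_axis]
      bounded_linear_const_scaleR bounded_linear_vec_nth)

definition right_mult :: "'n::{finite,linorder} clifford \<Rightarrow> ('h::{real_inner,banach}, 'n) clop" where
  "right_mult a = Blinfun (\<lambda>x. cl_right x a)"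

lemma right_mult_apply: "right_mult a x = cl_right x a"
  unfolding right_mult_def by (simp add: bounded_linear_Blinfun_apply[OF bounded_linear_cl_right])

lemma right_linear_iff: "right_linear T \<longleftrightarrow> (\<forall>a. right_mult a o\<^sub>L T = T o\<^sub>L right_mult a)"
  unfolding right_linear_def
proof (intro iffI allI)
  show "right_mult a o\<^sub>L T = T o\<^sub>L right_mult a" if "\<forall>x a. T (cl_right x a) = cl_right (T x) a" for a
    using that by (intro compose_eqI) (simp add: right_mult_apply)
  show "T (cl_right x a) = cl_right (T x) a" if "\<forall>a. right_mult a o\<^sub>L T = T o\<^sub>L right_mult a" for x a
    using compose_eqD[OF that[rule_format, of a], of x] by (simp add: right_mult_apply)
qed

section \<open>Spectral measures and integrals of bounded functions\<close>

text \<open>Rounding down to multiples of \<open>1 / (k + 1)\<close> gives simple functions that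
  approximate a bounded \<open>f\<close> uniformly from below.\<close>

definition floor_step :: "('a \<Rightarrow> real) \<Rightarrow> nat \<Rightarrow> 'a \<Rightarrow> real" where
  "floor_step f k t = real_of_int \<lfloor>real (Suc k) * f t\<rfloor> / real (Suc k)"

lemma floor_step_bounds: "floor_step f k t \<le> f t" "f t < floor_step f k t + 1 / real (Suc k)"
proof -
  have "real (Suc k) > 0" by simp
  then show "floor_step f k t \<le> f t" "f t < floor_step f k t + 1 / real (Suc k)"
    using of_int_floor_le[of "real (Suc k) * f t"] real_of_int_floor_add_one_gt[of "real (Suc k) * f t"]
    unfolding floor_step_def by (simp_all add: field_simps del: of_nat_Suc)
qed

lemma floor_step_simple:
  assumes f: "f \<in> borel_measurable M" "bounded (f ` space M)"
  shows "simple_function M (floor_step f k)"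
proof (rule simple_function_borel_measurable)
  have "(\<lambda>t. real_of_int \<lfloor>real (Suc k) * f t\<rfloor>) \<in> borel_measurable M"
    using f(1) by (intro measurable_compose[OF _ borel_measurable_real_floor]) simp
  then show "floor_step f k \<in> borel_measurable M"
    unfolding floor_step_def[abs_def] by (intro borel_measurable_divide) auto
  obtain B where B: "\<And>t. t \<in> space M \<Longrightarrow> \<bar>f t\<bar> \<le> B" using f(2) by (auto simp: bounded_iff)
  let ?R = "real (Suc k)"
  have "\<lfloor>?R * f t\<rfloor> \<in> {\<lfloor>- ?R * B\<rfloor>..\<lfloor>?R * B\<rfloor>}" if "t \<in> space M" for t
  proof -
    have "- ?R * B \<le> ?R * f t" "?R * f t \<le> ?R * B"
      using B[OF that] mult_left_mono[of "- B" "f t" ?R] mult_left_mono[of "f t" B ?R]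
      by (simp_all add: abs_le_iff del: of_nat_Suc)
    then show ?thesis by (simp add: floor_mono del: of_nat_Suc)
  qed
  then have "floor_step f k ` space M \<subseteq> (\<lambda>m. real_of_int m / ?R) ` {\<lfloor>- ?R * B\<rfloor>..\<lfloor>?R * B\<rfloor>}"
    unfolding floor_step_def by blast
  then show "finite (floor_step f k ` space M)" by (rule finite_subset) simp
qed

lemma floor_step_uniform: "uniform_limit S (floor_step f) f sequentially"
  unfolding uniform_limit_iff
proof (intro allI impI)
  fix e :: real assume "e > 0"
  then have "\<forall>\<^sub>F k in sequentially. 1 / real (Suc k) < e"
    using order_tendstoD(2)[OF LIMSEQ_Suc[OF lim_1_over_n]] by blast
  then show "\<forall>\<^sub>F k in sequentially. \<forall>t\<in>S. dist (floor_step f k t) (f t) < e"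
  proof eventually_elim
    case (elim k)
    show ?case
    proof
      fix t
      show "dist (floor_step f k t) (f t) < e"
        using floor_step_bounds[where f = f and k = k and t = t] elim by (simp add: dist_real_def abs_if del: of_nat_Suc)
    qed
  qed
qed

section \<open>Calculus of spectral measures\<close>

locale spectral_measure_space =
  fixes M :: "'a measure" and E :: "'a set \<Rightarrow> ('h::{real_inner,banach}, 'n::{finite,linorder}) clop"
  assumes spectral: "spectral_measure M E"
begin

lemma proj: "A \<in> sets M \<Longrightarrow> proj_op (E A)"
  using spectral by (simp add: spectral_measure_def orth_projection_proj_op)

lemma idem: "A \<in> sets M \<Longrightarrow> E A (E A x) = E A x"
  by (rule proj_op_idem[OF proj])

lemma space: "E (space M) x = x"
  using spectral by (simp add: spectral_measure_def)

lemma sums: "range A \<subseteq> sets M \<Longrightarrow> disjoint_family A \<Longrightarrow> (\<lambda>i::nat. E (A i) x) sums E (\<Union>i. A i) x"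
  using spectral by (simp add: spectral_measure_def)

text \<open>A convergent series with constant terms has zero terms.\<close>

lemma E_empty: "E {} x = 0"
proof -
  have "(\<lambda>i::nat. E {} x) sums E (\<Union>i::nat. {}) x"
    by (rule sums) (auto simp: disjoint_family_on_def)
  then have "(\<lambda>i::nat. E {} x) \<longlonglongrightarrow> 0" by (intro summable_LIMSEQ_zero sums_summable)
  then show ?thesis by (simp add: LIMSEQ_const_iff)
qed

lemma union:
  assumes "A \<in> sets M" "B \<in> sets M" "A \<inter> B = {}"
  shows "E (A \<union> B) x = E A x + E B x"
proof -
  have "(\<lambda>i. E (binaryset A B i) x) sums E (\<Union>i. binaryset A B i) x"
    using assms by (intro sums) (auto simp: binaryset_def disjoint_family_on_def)
  moreover have "(\<lambda>i. E (binaryset A B i) x) sums (\<Sum>i<2. E (binaryset A B i) x)"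
    by (rule sums_finite) (auto simp: binaryset_def E_empty)
  ultimately show ?thesis
    using sums_unique2 by (fastforce simp: UN_binaryset_eq binaryset_def numeral_2_eq_2)
qed

text \<open>Additivity alone forces orthogonality: the squared norms for \<open>A\<close> and
  \<open>B\<close> add up to that for the projection \<open>E (A \<union> B)\<close>.\<close>

lemma disjoint:
  assumes "A \<in> sets M" "B \<in> sets M" "A \<inter> B = {}"
  shows "E B (E A x) = 0"
proof (rule proj_op_disjoint[OF proj proj])
  have AB: "A \<union> B \<in> sets M" using assms by auto
  have "(norm (E A x))\<^sup>2 + (norm (E B x))\<^sup>2 = (norm (E (A \<union> B) x))\<^sup>2" for x
    using proj_op_inner_self[OF proj[OF AB], of x] proj_op_inner_self[OF proj[OF assms(1)], of x]
      proj_op_inner_self[OF proj[OF assms(2)], of x]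
    by (simp add: union[OF assms] inner_add_left)
  then show "(norm (E A x))\<^sup>2 + (norm (E B x))\<^sup>2 \<le> (norm x)\<^sup>2" for x
    using power_mono[OF proj_op_norm_le[OF proj[OF AB]] norm_ge_zero, of x 2] by simp
qed (use assms in auto)

text \<open>Both sets are split along \<open>A \<inter> B\<close>; the cross terms vanish by
  disjointness.\<close>

lemma inter:
  assumes A: "A \<in> sets M" and B: "B \<in> sets M"
  shows "E A (E B x) = E (A \<inter> B) x"
proof -
  have 1: "E B x = E (A \<inter> B) x + E (B - A) x" for x
  proof -
    have "A \<inter> B \<union> (B - A) = B" "(A \<inter> B) \<inter> (B - A) = {}" by auto
    then show ?thesis using union[of "A \<inter> B" "B - A" x] A B by (metis sets.Diff sets.Int)
  qed
  have 2: "E A x = E (A \<inter> B) x + E (A - B) x" for x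
  proof -
    have "A \<inter> B \<union> (A - B) = A" "(A \<inter> B) \<inter> (A - B) = {}" by auto
    then show ?thesis using union[of "A \<inter> B" "A - B" x] A B by (metis sets.Diff sets.Int)
  qed
  have "E A (E (B - A) x) = 0" using A B by (intro disjoint) auto
  moreover have "E (A - B) (E (A \<inter> B) x) = 0" using A B by (intro disjoint) auto
  moreover have "E (A \<inter> B) (E (A \<inter> B) x) = E (A \<inter> B) x" using A B by (intro idem) auto
  ultimately show ?thesis
    using 2[of "E (A \<inter> B) x"] by (simp add: 1[of x] blinfun.add_right)
qed

lemma commute: "A \<in> sets M \<Longrightarrow> B \<in> sets M \<Longrightarrow> E A o\<^sub>L E B = E B o\<^sub>L E A"
  by (rule compose_eqI) (simp add: inter Int_commute)

lemma compl: "A \<in> sets M \<Longrightarrow> E (space M - A) x = x - E A x"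
  using union[of A "space M - A" x] sets.sets_into_space[of A M] space[of x]
  by (simp add: Un_absorb1 algebra_simps)

lemma subset:
  assumes "A \<in> sets M" "B \<in> sets M" "A \<subseteq> B" "E A x = x"
  shows "E B x = x"
  using inter[OF assms(2,1), of x] assms(3,4) by (simp add: Int_absorb1)

lemma finite_union:
  assumes "finite I" "disjoint_family_on A I" "\<And>i. i \<in> I \<Longrightarrow> A i \<in> sets M"
  shows "E (\<Union>i\<in>I. A i) x = (\<Sum>i\<in>I. E (A i) x)"
  using assms
proof (induction I)
  case empty then show ?case by (simp add: E_empty)
next
  case (insert i I)
  have "A i \<inter> (\<Union>i\<in>I. A i) = {}" using insert.hyps insert.prems(1) by (auto simp: disjoint_family_on_def)
  moreover have "disjoint_family_on A I" using insert.prems(1) by (auto simp: disjoint_family_on_def)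
  ultimately show ?case
    using insert by (simp add: union sets.finite_UN)
qed

lemma incseq_limit:
  assumes S: "range S \<subseteq> sets M" "incseq S"
  shows "(\<lambda>n. E (S n) x) \<longlonglongrightarrow> E (\<Union>n. S n) x"
proof -
  have dS: "range (disjointed S) \<subseteq> sets M" using S(1) by (rule sets.range_disjointed_sets)
  have "(\<Sum>i<Suc n. E (disjointed S i) x) = E (S n) x" for n
  proof -
    have "E (\<Union>i\<in>{..<Suc n}. disjointed S i) x = (\<Sum>i<Suc n. E (disjointed S i) x)"
      using dS by (intro finite_union disjoint_family_on_mono[OF subset_UNIV disjoint_family_disjointed]) auto
    moreover have "(\<Union>i\<in>{..<Suc n}. disjointed S i) = S n"
      unfolding finite_UN_disjointed_eq[of S "Suc n", unfolded atLeast0LessThan]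
      using incseqD[OF S(2)] by (fastforce simp: less_Suc_eq_le)
    ultimately show ?thesis by simp
  qed
  moreover have "(\<lambda>n. \<Sum>i<Suc n. E (disjointed S i) x) \<longlonglongrightarrow> E (\<Union>n. S n) x"
    using LIMSEQ_Suc[OF sums[OF dS disjoint_family_disjointed, of x, unfolded sums_def]]
    by (simp only: UN_disjointed_eq)
  ultimately show ?thesis by simp
qed

text \<open>The operator \<open>D\<close> is block diagonal for the partition, so its form is the
  sum of the forms on the blocks.\<close>

lemma partition_bound:
  assumes I: "finite I" "disjoint_family_on A I" "\<And>i. i \<in> I \<Longrightarrow> A i \<in> sets M" "(\<Union>i\<in>I. A i) = space M"
    and D: "\<And>i. i \<in> I \<Longrightarrow> E (A i) o\<^sub>L D = D o\<^sub>L E (A i)"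
    and e: "\<And>i y. i \<in> I \<Longrightarrow> E (A i) y = y \<Longrightarrow> D y \<bullet> y \<le> e * (norm y)\<^sup>2"
  shows "D x \<bullet> x \<le> e * (norm x)\<^sup>2"
proof -
  have dec: "y = (\<Sum>i\<in>I. E (A i) y)" for y
    using finite_union[OF I(1-3), of y] I(4) space[of y] by simp
  have "D x \<bullet> x = (\<Sum>i\<in>I. E (A i) (D x) \<bullet> x)"
    by (subst dec[of "D x"]) (simp add: inner_sum_left)
  also have "\<dots> = (\<Sum>i\<in>I. D (E (A i) x) \<bullet> E (A i) x)"
  proof (rule sum.cong[OF refl])
    fix i assume i: "i \<in> I"
    have "E (A i) (D x) \<bullet> x = E (A i) (D x) \<bullet> E (A i) x"
      by (metis I(3) i idem proj proj_op_inner)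
    then show "E (A i) (D x) \<bullet> x = D (E (A i) x) \<bullet> E (A i) x"
      by (simp add: compose_eqD[OF D[OF i]])
  qed
  also have "\<dots> \<le> (\<Sum>i\<in>I. e * (norm (E (A i) x))\<^sup>2)"
    using I(3) by (intro sum_mono e) (auto intro: idem)
  also have "\<dots> = e * (\<Sum>i\<in>I. E (A i) x \<bullet> x)"
    using I(3) by (simp add: sum_distrib_left proj_op_inner_self[OF proj])
  also have "(\<Sum>i\<in>I. E (A i) x \<bullet> x) = (norm x)\<^sup>2"
    using arg_cong[OF dec, of "\<lambda>z. z \<bullet> x" x]
    by (simp only: inner_sum_left[symmetric] power2_norm_eq_inner)
  finally show ?thesis .
qed

lemma partition_norm_bound:
  assumes I: "finite I" "disjoint_family_on A I" "\<And>i. i \<in> I \<Longrightarrow> A i \<in> sets M" "(\<Union>i\<in>I. A i) = space M"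
    and D: "\<And>i. i \<in> I \<Longrightarrow> E (A i) o\<^sub>L D = D o\<^sub>L E (A i)" "sym_op D"
    and e: "0 \<le> e" "\<And>i y. i \<in> I \<Longrightarrow> E (A i) y = y \<Longrightarrow> \<bar>D y \<bullet> y\<bar> \<le> e * (norm y)\<^sup>2"
  shows "norm D \<le> e"
proof (rule norm_blinfun_bound[OF e(1)], rule sym_op_norm_bound[OF D(2)])
  fix x
  have "D x \<bullet> x \<le> e * (norm x)\<^sup>2"
  proof (rule partition_bound[where A = A, OF I D(1)])
    show "D y \<bullet> y \<le> e * (norm y)\<^sup>2" if "i \<in> I" "E (A i) y = y" for i y
      using e(2)[OF that] by (simp add: abs_le_iff)
  qed
  moreover have "(- D) x \<bullet> x \<le> e * (norm x)\<^sup>2"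
  proof (rule partition_bound[where A = A, OF I])
    show "E (A i) o\<^sub>L (- D) = (- D) o\<^sub>L E (A i)" if "i \<in> I" for i
      using compose_eqD[OF D(1)[OF that]]
      by (intro compose_eqI) (simp add: blinfun.minus_left blinfun.minus_right)
    show "(- D) y \<bullet> y \<le> e * (norm y)\<^sup>2" if "i \<in> I" "E (A i) y = y" for i y
      using e(2)[OF that] by (simp add: blinfun.minus_left abs_le_iff)
  qed
  ultimately show "\<bar>D x \<bullet> x\<bar> \<le> e * (norm x)\<^sup>2" by (simp add: blinfun.minus_left abs_le_iff)
qed

section \<open>Integrals of simple functions\<close>

abbreviation simple_int :: "('a \<Rightarrow> real) \<Rightarrow> ('h, 'n) clop" where
  "simple_int \<equiv> spectral_integral_simple M E"

lemma simple_int_sym: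
  assumes "simple_function M g"
  shows "sym_op (simple_int g)"
  unfolding spectral_integral_simple_def
  using proj[OF simple_functionD(2)[OF assms]]
  by (intro sym_op_sum sym_op_scaleR) (simp add: proj_op_def)

lemma simple_int_commute:
  assumes g: "simple_function M g" and W: "\<And>A. A \<in> sets M \<Longrightarrow> W o\<^sub>L E A = E A o\<^sub>L W"
  shows "W o\<^sub>L simple_int g = simple_int g o\<^sub>L W"
  unfolding spectral_integral_simple_def
  by (rule compose_eqI)
    (simp add: blinfun.sum_left blinfun.sum_right blinfun.bilinear_simps
      compose_eqD[OF W[OF simple_functionD(2)[OF g]]])

lemma simple_int_eigen:
  assumes g: "simple_function M g" and A: "A \<in> sets M" "\<And>t. t \<in> A \<Longrightarrow> g t = c" and y: "E A y = y"
  shows "simple_int g y = c *\<^sub>R y"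
proof (cases "A = {}")
  case True
  then show ?thesis using y by (simp add: E_empty)
next
  case False
  have AM: "A \<subseteq> space M" using A(1) by (rule sets.sets_into_space)
  have fib: "E (g -` {d} \<inter> space M) y = (if d = c then y else 0)" for d
  proof -
    have "E (g -` {d} \<inter> space M) y = E (g -` {d} \<inter> space M \<inter> A) y"
      using inter[OF simple_functionD(2)[OF g] A(1), of "{d}" y] y by simp
    also have "g -` {d} \<inter> space M \<inter> A = (if d = c then A else {})" using A(2) AM by auto
    finally show ?thesis using y by (auto simp: E_empty)
  qed
  have "simple_int g y = (\<Sum>d\<in>g ` space M. if d = c then c *\<^sub>R y else 0)"
    unfolding spectral_integral_simple_def blinfun.sum_left
    by (intro sum.cong) (simp_all add: blinfun.bilinear_simps fib)
  also have "\<dots> = c *\<^sub>R y"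
    using False A(2) AM simple_functionD(1)[OF g] by auto
  finally show ?thesis .
qed

lemma simple_int_diff_norm:
  assumes g: "simple_function M g" and h: "simple_function M h"
    and e: "0 \<le> e" "\<And>t. t \<in> space M \<Longrightarrow> \<bar>g t - h t\<bar> \<le> e"
  shows "norm (simple_int g - simple_int h) \<le> e"
proof -
  \<comment> \<open>The fibres of the pair form a common refinement of both level partitions; on
    each of them the two integrals act as scalars.\<close>
  define p where "p = (\<lambda>t. (g t, h t))"
  have p: "simple_function M p" unfolding p_def using g h by simp
  define A where "A c = p -` {c} \<inter> space M" for c
  have A: "finite (p ` space M)" "disjoint_family_on A (p ` space M)"
    "\<And>c. A c \<in> sets M" "(\<Union>c\<in>p ` space M. A c) = space M"
    using simple_functionD[OF p] by (auto simp: A_def disjoint_family_on_def)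
  have com: "E (A c) o\<^sub>L (simple_int g - simple_int h) = (simple_int g - simple_int h) o\<^sub>L E (A c)" for c
    using compose_eqD[OF simple_int_commute[OF g commute[OF A(3)]]]
      compose_eqD[OF simple_int_commute[OF h commute[OF A(3)]]]
    by (intro compose_eqI) (simp add: blinfun.bilinear_simps)
  show ?thesis
  proof (rule partition_norm_bound[where A = A, OF A(1,2,3,4) com _ e(1)])
    show "sym_op (simple_int g - simple_int h)"
      by (intro sym_op_diff simple_int_sym g h)
    fix c y assume c: "c \<in> p ` space M" and y: "E (A c) y = y"
    have "simple_int g y = fst c *\<^sub>R y" "simple_int h y = snd c *\<^sub>R y"
      by (intro simple_int_eigen[OF _ A(3) _ y] g h; auto simp: A_def p_def)+
    then have "(simple_int g - simple_int h) y \<bullet> y = (fst c - snd c) * (norm y)\<^sup>2"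
      by (simp add: blinfun.bilinear_simps inner_diff_left left_diff_distrib power2_norm_eq_inner)
    moreover have "\<bar>fst c - snd c\<bar> \<le> e"
      using c e(2) by (auto simp: p_def)
    ultimately show "\<bar>(simple_int g - simple_int h) y \<bullet> y\<bar> \<le> e * (norm y)\<^sup>2"
      by (simp add: abs_mult mult_right_mono)
  qed
qed

text \<open>For \<open>y\<close> in the range of \<open>E A\<close> only the level sets of
  \<open>g\<close> that meet \<open>A\<close> contribute to the form.\<close>

lemma simple_int_bounds:
  assumes g: "simple_function M g" and A: "A \<in> sets M" and y: "E A y = y"
  shows simple_int_le: "(\<And>t. t \<in> A \<Longrightarrow> g t \<le> c) \<Longrightarrow> simple_int g y \<bullet> y \<le> c * (norm y)\<^sup>2"
    and simple_int_ge: "(\<And>t. t \<in> A \<Longrightarrow> c \<le> g t) \<Longrightarrow> c * (norm y)\<^sup>2 \<le> simple_int g y \<bullet> y"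
proof -
  let ?B = "\<lambda>d. g -` {d} \<inter> space M"
  have B: "?B d \<in> sets M" for d by (rule simple_functionD(2)[OF g])
  have eq: "simple_int g y \<bullet> y = (\<Sum>d\<in>g ` space M. d * (norm (E (?B d) y))\<^sup>2)"
    unfolding spectral_integral_simple_def
    by (simp add: blinfun.sum_left blinfun.bilinear_simps inner_sum_left proj_op_inner_self[OF proj[OF B]])
  have "y = (\<Sum>d\<in>g ` space M. E (?B d) y)"
  proof -
    have "E (\<Union>d\<in>g ` space M. ?B d) y = (\<Sum>d\<in>g ` space M. E (?B d) y)"
      using simple_functionD[OF g] by (intro finite_union) (auto simp: disjoint_family_on_def)
    moreover have "(\<Union>d\<in>g ` space M. ?B d) = space M" by auto
    ultimately show ?thesis by (simp add: space)
  qed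
  from arg_cong[OF this, of "\<lambda>z. z \<bullet> y"]
  have total: "(norm y)\<^sup>2 = (\<Sum>d\<in>g ` space M. (norm (E (?B d) y))\<^sup>2)"
    by (simp add: inner_sum_left proj_op_inner_self[OF proj[OF B]] power2_norm_eq_inner)
  have null: "E (?B d) y = 0" if "\<And>t. t \<in> A \<Longrightarrow> g t \<noteq> d" for d
  proof -
    have "?B d \<inter> A = {}" using that by auto
    then show ?thesis using inter[OF B A, of d y] y by (simp add: E_empty)
  qed
  show "simple_int g y \<bullet> y \<le> c * (norm y)\<^sup>2" if c: "\<And>t. t \<in> A \<Longrightarrow> g t \<le> c"
    unfolding eq total sum_distrib_left
  proof (rule sum_mono)
    \<comment> \<open>If \<open>d > c\<close>, the level set misses \<open>A\<close> and both sides
      are zero.\<close>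
    show "d * (norm (E (?B d) y))\<^sup>2 \<le> c * (norm (E (?B d) y))\<^sup>2" for d
      using null[of d] c by (cases "d \<le> c") (force intro: mult_right_mono)+
  qed
  show "c * (norm y)\<^sup>2 \<le> simple_int g y \<bullet> y" if c: "\<And>t. t \<in> A \<Longrightarrow> c \<le> g t"
    unfolding eq total sum_distrib_left
  proof (rule sum_mono)
    show "c * (norm (E (?B d) y))\<^sup>2 \<le> d * (norm (E (?B d) y))\<^sup>2" for d
      using null[of d] c by (cases "c \<le> d") (force intro: mult_right_mono)+
  qed
qed

lemma simple_int_convergent:
  assumes g: "\<And>k. simple_function M (g k)" and lim: "uniform_limit (space M) g f sequentially"
  shows "convergent (\<lambda>k. simple_int (g k))"
proof (rule Cauchy_convergent, rule metric_CauchyI)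
  fix e :: real assume e: "e > 0"
  have "\<forall>\<^sub>F k in sequentially. \<forall>t\<in>space M. dist (g k t) (f t) < e / 4"
    using lim[unfolded uniform_limit_iff, rule_format, of "e / 4"] e by simp
  then obtain N where N: "\<And>k t. k \<ge> N \<Longrightarrow> t \<in> space M \<Longrightarrow> \<bar>g k t - f t\<bar> < e / 4"
    by (auto simp: eventually_sequentially dist_real_def)
  have "dist (simple_int (g m)) (simple_int (g n)) < e" if "m \<ge> N" "n \<ge> N" for m n
  proof -
    have "\<bar>g m t - g n t\<bar> \<le> e / 2" if "t \<in> space M" for t
      using N[OF \<open>m \<ge> N\<close> that] N[OF \<open>n \<ge> N\<close> that] by linarith
    then have "norm (simple_int (g m) - simple_int (g n)) \<le> e / 2"
      using e by (intro simple_int_diff_norm g) auto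
    then show ?thesis using e by (simp add: dist_norm)
  qed
  then show "\<exists>N. \<forall>m\<ge>N. \<forall>n\<ge>N. dist (simple_int (g m)) (simple_int (g n)) < e" by blast
qed

lemma simple_int_limit_unique:
  assumes g: "\<And>k. simple_function M (g k)" "uniform_limit (space M) g f sequentially"
    and h: "\<And>k. simple_function M (h k)" "uniform_limit (space M) h f sequentially"
    and L: "(\<lambda>k. simple_int (g k)) \<longlonglongrightarrow> L" "(\<lambda>k. simple_int (h k)) \<longlonglongrightarrow> L'"
  shows "L = L'"
proof -
  \<comment> \<open>Interleaving the two sequences gives one that converges uniformly to
    \<open>f\<close>; its integrals converge, so both subsequences share their limit.\<close>
  define w where "w k = (if even k then g (k div 2) else h (k div 2))" for k
  have w2: "(\<lambda>k. w (2 * k)) = g" "(\<lambda>k. w (2 * k + 1)) = h" by (auto simp: w_def)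
  have "uniform_limit (space M) w f sequentially"
    unfolding uniform_limit_iff
  proof (intro allI impI)
    fix e :: real assume "e > 0"
    then obtain N N' where "\<forall>k\<ge>N. \<forall>t\<in>space M. dist (g k t) (f t) < e" "\<forall>k\<ge>N'. \<forall>t\<in>space M. dist (h k t) (f t) < e"
      using g(2) h(2) unfolding uniform_limit_iff eventually_sequentially by meson
    then have "\<forall>t\<in>space M. dist (w k t) (f t) < e" if "k \<ge> 2 * (N + N')" for k
      using that by (auto simp: w_def)
    then show "\<forall>\<^sub>F k in sequentially. \<forall>t\<in>space M. dist (w k t) (f t) < e"
      unfolding eventually_sequentially by blast
  qed
  moreover have "simple_function M (w k)" for k using g(1) h(1) by (simp add: w_def)
  ultimately obtain K where K: "(\<lambda>k. simple_int (w k)) \<longlonglongrightarrow> K"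
    using simple_int_convergent unfolding convergent_def by blast
  have "(\<lambda>k. simple_int (g k)) \<longlonglongrightarrow> K" "(\<lambda>k. simple_int (h k)) \<longlonglongrightarrow> K"
    using LIMSEQ_subseq_LIMSEQ[OF K, of "\<lambda>k. 2 * k"] LIMSEQ_subseq_LIMSEQ[OF K, of "\<lambda>k. 2 * k + 1"]
    by (simp_all add: strict_mono_def o_def w_def)
  with L show ?thesis using LIMSEQ_unique by metis
qed

section \<open>Integrals of bounded functions\<close>

abbreviation bdd_int :: "('a \<Rightarrow> real) \<Rightarrow> ('h, 'n) clop" where
  "bdd_int \<equiv> spectral_integral_bounded M E"

lemma bdd_int_limit:
  assumes g: "\<And>k. simple_function M (g k)" and lim: "uniform_limit (space M) g f sequentially"
  shows "(\<lambda>k. simple_int (g k)) \<longlonglongrightarrow> bdd_int f"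
proof -
  obtain L where L: "(\<lambda>k. simple_int (g k)) \<longlonglongrightarrow> L"
    using simple_int_convergent[OF assms] by (auto simp: convergent_def)
  have "bdd_int f = L"
    unfolding spectral_integral_bounded_def
  proof (rule the_equality)
    show "\<exists>g. (\<forall>k. simple_function M (g k)) \<and> uniform_limit (space M) g f sequentially \<and>
        (\<lambda>k. simple_int (g k)) \<longlonglongrightarrow> L"
      using g lim L by blast
  qed (use simple_int_limit_unique[OF _ _ g lim _ L] in blast)
  with L show ?thesis by simp
qed

context
  fixes f :: "'a \<Rightarrow> real"
  assumes f: "f \<in> borel_measurable M" "bounded (f ` space M)"
begin

lemma floor_step_limit: "(\<lambda>k. simple_int (floor_step f k)) \<longlonglongrightarrow> bdd_int f"
  by (intro bdd_int_limit floor_step_simple f floor_step_uniform)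

lemma bdd_int_sym: "sym_op (bdd_int f)"
  by (rule sym_op_limit[OF simple_int_sym floor_step_limit]) (rule floor_step_simple[OF f])

lemma bdd_int_commute:
  assumes "\<And>A. A \<in> sets M \<Longrightarrow> W o\<^sub>L E A = E A o\<^sub>L W"
  shows "W o\<^sub>L bdd_int f = bdd_int f o\<^sub>L W"
  by (rule commute_limit[OF simple_int_commute floor_step_limit]) (use floor_step_simple[OF f] assms in auto)

lemma bdd_int_le:
  assumes A: "A \<in> sets M" "E A y = y" and c: "\<And>t. t \<in> A \<Longrightarrow> f t \<le> c"
  shows "bdd_int f y \<bullet> y \<le> c * (norm y)\<^sup>2"
proof (rule LIMSEQ_le_const2)
  show "(\<lambda>k. simple_int (floor_step f k) y \<bullet> y) \<longlonglongrightarrow> bdd_int f y \<bullet> y"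
    by (intro tendsto_intros floor_step_limit)
  show "\<exists>N. \<forall>k\<ge>N. simple_int (floor_step f k) y \<bullet> y \<le> c * (norm y)\<^sup>2"
  proof (intro exI allI impI simple_int_le[OF floor_step_simple[OF f] A])
    fix k t assume "t \<in> A"
    from floor_step_bounds(1) c[OF this] show "floor_step f k t \<le> c" by (rule order_trans)
  qed
qed

text \<open>Rounding down may lower the bound by \<open>1 / (k + 1)\<close>, so \<open>c\<close> is
  recovered only in the limit; an upper bound survives the rounding unchanged.\<close>

lemma bdd_int_ge:
  assumes A: "A \<in> sets M" "E A y = y" and c: "\<And>t. t \<in> A \<Longrightarrow> c \<le> f t"
  shows "c * (norm y)\<^sup>2 \<le> bdd_int f y \<bullet> y"
proof (rule LIMSEQ_le)
  show "(\<lambda>k. simple_int (floor_step f k) y \<bullet> y) \<longlonglongrightarrow> bdd_int f y \<bullet> y"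
    by (intro tendsto_intros floor_step_limit)
  have "(\<lambda>k. (c - 1 / real (Suc k)) * (norm y)\<^sup>2) \<longlonglongrightarrow> (c - 0) * (norm y)\<^sup>2"
    by (intro tendsto_intros LIMSEQ_Suc[OF lim_1_over_n])
  then show "(\<lambda>k. (c - 1 / real (Suc k)) * (norm y)\<^sup>2) \<longlonglongrightarrow> c * (norm y)\<^sup>2" by simp
  show "\<exists>N. \<forall>k\<ge>N. (c - 1 / real (Suc k)) * (norm y)\<^sup>2 \<le> simple_int (floor_step f k) y \<bullet> y"
  proof (intro exI allI impI simple_int_ge[OF floor_step_simple[OF f] A])
    fix k t assume "t \<in> A"
    from c[OF this] show "c - 1 / real (Suc k) \<le> floor_step f k t"
      using floor_step_bounds(2)[where f = f and k = k and t = t] by linarith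
  qed
qed

end

end

section \<open>The real part of the S-spectrum\<close>

lemma cl_Re_of_real [simp]: "cl_Re (cl_of_real r) = r"
  by (simp add: cl_Re_def cl_of_real_def cl_basis_nth)

lemma norm_cl_of_real: "(norm (cl_of_real r :: 'n::{finite,linorder} clifford))\<^sup>2 = r\<^sup>2"
  by (simp add: cl_of_real_def cl_basis_def)

lemma cl_of_real_paravector: "cl_of_real r \<in> paravectors"
  by (auto simp: paravectors_def cl_of_real_def cl_basis_nth)

lemma continuous_cl_of_real: "continuous_on S cl_of_real"
  unfolding cl_of_real_def by (intro continuous_intros)

lemma borel_measurable_cl_Re: "cl_Re \<in> borel_measurable borel"
  unfolding cl_Re_def by (intro borel_measurable_continuous_onI continuous_intros)

lemma Q_op_of_real: "Q_op (cl_of_real r) T x = T (T x - r *\<^sub>R x) - r *\<^sub>R (T x - r *\<^sub>R x)"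
  by (simp add: Q_op_def norm_cl_of_real blinfun.bilinear_simps)
    (simp add: power2_eq_square algebra_simps scaleR_2 flip: scaleR_scaleR)

text \<open>At a real point \<open>Q_op\<close> is the square of \<open>A = T - r\<close>, and
  bounded invertibility of the square amounts to \<open>A\<close> being bounded below.\<close>

lemma real_resolvent_iff:
  fixes T :: "('h::{real_inner,banach}, 'n::{finite,linorder}) clop"
  assumes T: "sym_op T"
  shows "cl_of_real r \<in> S_resolvent T \<longleftrightarrow> (\<exists>c>0. \<forall>x. c * norm x \<le> norm (T x - r *\<^sub>R x))"
proof
  let ?Q = "Q_op (cl_of_real r) T"
  define A where "A = T - r *\<^sub>R id_blinfun"
  have A: "A x = T x - r *\<^sub>R x" for x by (simp add: A_def blinfun.bilinear_simps)
  have QA: "?Q x = A (A x)" for x by (simp add: A Q_op_of_real)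
  {
    assume "cl_of_real r \<in> S_resolvent T"
    then have res: "(\<forall>x. ?Q x = 0 \<longrightarrow> x = 0) \<and>
        (\<exists>C. \<forall>y\<in>range ?Q. norm (inv ?Q y) \<le> C * norm y)"
      unfolding S_resolvent_def mem_Collect_eq by (elim conjE) (intro conjI)
    have inj: "inj (blinfun_apply ?Q)"
    proof (rule injI)
      fix x y assume "?Q x = ?Q y"
      then have "?Q (x - y) = 0" by (simp only: blinfun.diff_right diff_self)
      with res have "x - y = 0" by (elim conjE allE[of _ "x - y"] impE)
      then show "x = y" by (simp only: right_minus_eq)
    qed
    from res obtain C where "\<forall>y\<in>range ?Q. norm (inv ?Q y) \<le> C * norm y" by (elim conjE exE)
    from bspec[OF this rangeI] have C: "norm x \<le> C * norm (?Q x)" for x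
      by (simp only: inv_f_f[OF inj])
    \<comment> \<open>From \<open>norm x \<le> \<bar>C\<bar> * norm (A (A x))\<close> one factor
      \<open>A\<close> is absorbed into its norm; the \<open>1\<close> keeps \<open>K\<close>
      positive.\<close>
    define K where "K = \<bar>C\<bar> * norm A + 1"
    have K: "K > 0" by (simp add: K_def add_nonneg_pos)
    have "norm x \<le> K * norm (A x)" for x
    proof -
      have "norm x \<le> \<bar>C\<bar> * norm (A (A x))"
        using C[of x] mult_right_mono[OF abs_ge_self[of C] norm_ge_zero[of "?Q x"]] by (simp add: QA)
      also have "\<dots> \<le> \<bar>C\<bar> * (norm A * norm (A x))"
        by (intro mult_left_mono norm_blinfun) simp
      also have "\<dots> \<le> K * norm (A x)" by (simp add: K_def algebra_simps)
      finally show ?thesis .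
    qed
    then show "\<exists>c>0. \<forall>x. c * norm x \<le> norm (T x - r *\<^sub>R x)"
      using K by (intro exI[of _ "1 / K"]) (simp add: field_simps A)
  }
  assume "\<exists>c>0. \<forall>x. c * norm x \<le> norm (T x - r *\<^sub>R x)"
  then obtain c where c: "c > 0" "\<And>x. c * norm x \<le> norm (A x)" by (auto simp: A)
  have symA: "sym_op A" unfolding A_def by (intro sym_op_diff sym_op_scaleR sym_op_id T)
  have lower: "c\<^sup>2 * norm x \<le> norm (?Q x)" for x
    using order_trans[OF mult_left_mono[OF c(2)[of x], of c] c(2)[of "A x"]] c(1)
    by (simp add: QA power2_eq_square mult.assoc)
  \<comment> \<open>By symmetry the form of \<open>?Q\<close> is the squared norm of
    \<open>A x\<close>, so \<open>?Q\<close> is coercive and therefore onto.\<close>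
  have "c\<^sup>2 * (norm x)\<^sup>2 \<le> ?Q x \<bullet> x" for x
    using power_mono[OF c(2)[of x], of 2] c(1)
    by (simp add: QA sym_opD[OF symA, of "A x" x] power_mult_distrib dot_square_norm)
  then have surj: "range ?Q = UNIV" using c(1) by (intro coercive_surj[of "c\<^sup>2"]) auto
  show "cl_of_real r \<in> S_resolvent T"
    unfolding S_resolvent_def
  proof (intro CollectI conjI allI impI exI[of _ "1 / c\<^sup>2"] ballI cl_of_real_paravector)
    show "x = 0" if "?Q x = 0" for x
      using lower[of x] that c(1) by (simp add: mult_le_0_iff)
    show "closure (range ?Q) = UNIV" by (simp add: surj)
    show "norm (inv ?Q y) \<le> (1 / c\<^sup>2) * norm y" for y
      using lower[of "inv ?Q y"] surj c(1) by (simp add: surj_f_inv_f field_simps)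
  qed
qed

text \<open>The spectrum read on the real line, where the projections live; for self-adjoint
  \<open>T\<close> this loses nothing, by \<open>S_spectrum_real\<close>.\<close>

definition real_spectrum :: "('h::{real_inner,banach}, 'n::{finite,linorder}) clop \<Rightarrow> real set" where
  "real_spectrum T = cl_of_real -` S_spectrum T"

lemma real_resolvent:
  fixes T :: "('h::{real_inner,banach}, 'n::{finite,linorder}) clop"
  assumes T: "sym_op T"
  shows "r \<notin> real_spectrum T \<longleftrightarrow> (\<exists>c>0. \<forall>x. c * norm x \<le> norm (T x - r *\<^sub>R x))"
  using real_resolvent_iff[OF T, of r]
  by (simp add: real_spectrum_def S_spectrum_def cl_of_real_paravector)

text \<open>Half of the lower bound at \<open>r\<close> serves both as the radius and as the lower
  bound that remains.\<close>

lemma real_resolvent_neighbourhood: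
  fixes T :: "('h::{real_inner,banach}, 'n::{finite,linorder}) clop"
  assumes T: "sym_op T" and r: "r \<notin> real_spectrum T"
  obtains c where "c > 0" "\<And>s x. \<bar>s - r\<bar> < c \<Longrightarrow> c * norm x \<le> norm (T x - s *\<^sub>R x)"
proof -
  obtain d where d: "d > 0" "\<And>x. d * norm x \<le> norm (T x - r *\<^sub>R x)"
    using r real_resolvent[OF T] by blast
  have "d / 2 * norm x \<le> norm (T x - s *\<^sub>R x)" if "\<bar>s - r\<bar> < d / 2" for s x
  proof -
    have "norm (T x - r *\<^sub>R x) \<le> norm (T x - s *\<^sub>R x) + norm ((s - r) *\<^sub>R x)"
      using norm_triangle_ineq[of "T x - s *\<^sub>R x" "(s - r) *\<^sub>R x"] by (simp add: algebra_simps)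
    moreover have "norm ((s - r) *\<^sub>R x) \<le> d / 2 * norm x"
      using that mult_right_mono[of "\<bar>s - r\<bar>" "d / 2" "norm x"] by simp
    ultimately show ?thesis using d(2)[of x] by linarith
  qed
  with d(1) show thesis by (intro that[of "d / 2"]) auto
qed

lemma closed_real_spectrum:
  fixes T :: "('h::{real_inner,banach}, 'n::{finite,linorder}) clop"
  assumes T: "sym_op T"
  shows "closed (real_spectrum T)"
  unfolding closed_def open_dist
proof
  fix r assume "r \<in> - real_spectrum T"
  then obtain c where c: "c > 0" "\<And>s x. \<bar>s - r\<bar> < c \<Longrightarrow> c * norm x \<le> norm (T x - s *\<^sub>R x)"
    using real_resolvent_neighbourhood[OF T] by blast
  then have "s \<in> - real_spectrum T" if "dist s r < c" for s
    using that real_resolvent[OF T, of s] by (auto simp: dist_real_def)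
  with c(1) show "\<exists>e>0. \<forall>s. dist s r < e \<longrightarrow> s \<in> - real_spectrum T" by blast
qed

lemma real_spectrum_bound:
  fixes T :: "('h::{real_inner,banach}, 'n::{finite,linorder}) clop"
  assumes T: "sym_op T" and r: "r \<in> real_spectrum T"
  shows "\<bar>r\<bar> \<le> norm T"
proof (rule ccontr)
  assume "\<not> \<bar>r\<bar> \<le> norm T"
  moreover have "(\<bar>r\<bar> - norm T) * norm x \<le> norm (T x - r *\<^sub>R x)" for x
    using norm_triangle_ineq2[of "r *\<^sub>R x" "T x"] norm_blinfun[of T x]
    by (simp add: norm_minus_commute left_diff_distrib)
  ultimately have "r \<notin> real_spectrum T"
    unfolding real_resolvent[OF T] by (intro exI[of _ "\<bar>r\<bar> - norm T"]) auto
  with r show False by simp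
qed

section \<open>The spectral theorem\<close>

context
  fixes T :: "('h::{real_inner,banach}, 'n::{finite,linorder}) clop"
  assumes right: "right_linear T" and self: "self_adjoint T"
begin

interpretation symmetric_operator T
  by unfold_locales (rule self_adjoint_sym_op[OF self])

lemma spectral_set_proj_commute:
  "M \<in> sets borel \<Longrightarrow> W o\<^sub>L T = T o\<^sub>L W \<Longrightarrow> W o\<^sub>L spectral_set_proj M = spectral_set_proj M o\<^sub>L W"
  using spectral_set_proj[of M] by (simp add: spectral_proj_def)

text \<open>Right multiplications commute with \<open>T\<close> and hence with each spectral
  projection, which makes the projections right linear.\<close>

lemma spectral_measure_real: "spectral_measure borel spectral_set_proj"
  unfolding spectral_measure_def
proof (intro conjI ballI allI impI)
  fix A :: "real set" assume A: "A \<in> sets borel"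
  then have "right_linear (spectral_set_proj A)"
    using right unfolding right_linear_iff by (auto intro: spectral_set_proj_commute)
  moreover have "proj_op (spectral_set_proj A)" using spectral_set_proj[OF A] by (simp add: spectral_proj_def)
  ultimately show "orth_projection (spectral_set_proj A)" by (rule orth_projectionI)
qed (simp_all add: spectral_set_proj_UNIV spectral_set_proj_sums)

interpretation G: spectral_measure_space borel spectral_set_proj
  by unfold_locales (rule spectral_measure_real)

section \<open>The operator on ranges of its spectral projections\<close>

lemma range_le:
  assumes A: "A \<in> sets borel" "A \<subseteq> {..b}" and y: "spectral_set_proj A y = y"
  shows "T y \<bullet> y \<le> b * (norm y)\<^sup>2"
proof -
  have "resolution b y = y"
    using G.subset[OF A(1) _ A(2) y] by (simp add: spectral_set_proj_atMost)
  then show ?thesis using resolution_below[of b] by (simp add: spectral_below_def)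
qed

text \<open>The range of the projection of \<open>A\<close> lies in the kernel of
  \<open>resolution a\<close>, where the form exceeds \<open>a\<close> at every nonzero
  vector.\<close>

lemma range_ge:
  assumes A: "A \<in> sets borel" "A \<subseteq> {a<..}" and y: "spectral_set_proj A y = y"
  shows "a * (norm y)\<^sup>2 \<le> T y \<bullet> y"
proof (rule ccontr)
  assume *: "\<not> ?thesis"
  have "{..a} \<inter> A = {}" using A(2) by auto
  then have "resolution a y = 0"
    using G.inter[of "{..a}" A y] A(1) y by (simp add: spectral_set_proj_atMost G.E_empty)
  then have "y = 0" using * resolution_below[of a] by (auto simp: spectral_below_def)
  with * show False by simp
qed

lemma spectral_set_proj_interval:
  assumes y: "spectral_set_proj {r - e<..r + e} y = y" and e: "e > 0"
  shows "norm (T y - r *\<^sub>R y) \<le> e * norm y"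
proof -
  define P where "P = spectral_set_proj {r - e<..r + e}"
  \<comment> \<open>Compressing to the range of \<open>P\<close> gives a symmetric operator on the
    whole space, so that its form bounds its norm.\<close>
  define D where "D = (T - r *\<^sub>R id_blinfun) o\<^sub>L P"
  have P: "proj_op P" unfolding P_def by (rule G.proj) simp
  have TP: "T o\<^sub>L P = P o\<^sub>L T" unfolding P_def by (rule spectral_set_proj_commute) auto
  have "sym_op D"
    unfolding D_def using P TP compose_eqD[OF TP]
    by (intro sym_op_compose sym_op_diff sym_op_scaleR sym_op_id sym compose_eqI)
      (simp_all add: proj_op_def blinfun.bilinear_simps)
  moreover have "\<bar>D x \<bullet> x\<bar> \<le> e * (norm x)\<^sup>2" for x
  proof -
    define z where "z = P x"
    have z: "spectral_set_proj {r - e<..r + e} z = z"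
      using proj_op_idem[OF P, of x] by (simp add: z_def P_def)
    have "(r - e) * (norm z)\<^sup>2 \<le> T z \<bullet> z" "T z \<bullet> z \<le> (r + e) * (norm z)\<^sup>2"
      by (rule range_ge[OF _ _ z] range_le[OF _ _ z]; auto)+
    then have "\<bar>T z \<bullet> z - r * (norm z)\<^sup>2\<bar> \<le> e * (norm z)\<^sup>2"
      by (simp add: abs_le_iff algebra_simps)
    moreover have "D x \<bullet> x = T z \<bullet> z - r * (norm z)\<^sup>2"
    proof -
      have "T z = P (T z)" using compose_eqD[OF TP, of z] proj_op_idem[OF P, of x] by (simp add: z_def)
      then have "T z \<bullet> x = T z \<bullet> z" using proj_op_inner[OF P, of "T z" x] by (simp add: z_def)
      moreover have "z \<bullet> x = (norm z)\<^sup>2" unfolding z_def by (rule proj_op_inner_self[OF P])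
      ultimately show ?thesis by (simp add: D_def z_def[symmetric] blinfun.bilinear_simps inner_diff_left)
    qed
    moreover have "e * (norm z)\<^sup>2 \<le> e * (norm x)\<^sup>2"
      using e proj_op_norm_le[OF P, of x] by (simp add: z_def power_mono)
    ultimately show ?thesis by simp
  qed
  ultimately have "norm (D y) \<le> e * norm y" by (rule sym_op_norm_bound)
  then show ?thesis using y by (simp add: D_def P_def blinfun.bilinear_simps)
qed

text \<open>Each point off the spectrum has an interval with zero projection. By the Lindelof
  property countably many of these cover the complement, and countable unions of null sets are
  null.\<close>

lemma spectral_set_proj_resolvent: "spectral_set_proj (- real_spectrum T) x = 0"
proof -
  let ?I = "\<lambda>r c. {r - c<..r + c}"
  define \<U> where "\<U> = {{r - c<..<r + c} |r c. c > 0 \<and> (\<forall>y. spectral_set_proj (?I r c) y = 0)}"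
  have "r \<in> \<Union>\<U>" if r: "r \<notin> real_spectrum T" for r
  proof -
    obtain c where c: "c > 0" "\<And>s x. \<bar>s - r\<bar> < c \<Longrightarrow> c * norm x \<le> norm (T x - s *\<^sub>R x)"
      using real_resolvent_neighbourhood[OF sym r] by blast
    \<comment> \<open>On the range for radius \<open>c/2\<close> the operator \<open>T - r\<close>
      has norm at most \<open>c/2\<close>, yet it is bounded below by \<open>c\<close>.\<close>
    have "spectral_set_proj (?I r (c/2)) y = 0" for y
    proof -
      define z where "z = spectral_set_proj (?I r (c/2)) y"
      have "spectral_set_proj (?I r (c/2)) z = z" unfolding z_def by (rule G.idem) simp
      from spectral_set_proj_interval[OF this] c(2)[of r z] c(1)
      have "norm (T z - r *\<^sub>R z) * 2 \<le> c * norm z" "c * norm z \<le> norm (T z - r *\<^sub>R z)" by simp_all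
      then have "c * norm z \<le> 0" by linarith
      with c(1) have "z = 0" by (simp add: mult_le_0_iff)
      then show ?thesis by (simp add: z_def)
    qed
    then have "{r - c/2<..<r + c/2} \<in> \<U>" using c(1) unfolding \<U>_def by force
    moreover have "r \<in> {r - c/2<..<r + c/2}" using c(1) by simp
    ultimately show ?thesis by blast
  qed
  then have cover: "- real_spectrum T \<subseteq> \<Union>\<U>" by blast
  have "open U" if "U \<in> \<U>" for U using that by (auto simp: \<U>_def)
  then obtain \<V> where \<V>: "\<V> \<subseteq> \<U>" "countable \<V>" "\<Union>\<V> = \<Union>\<U>" using Lindelof by blast
  have null: "U \<in> null_sets (spectral_dist x)" if UV: "U \<in> \<V>" for U
  proof -
    obtain r c where U: "U = {r - c<..<r + c}" "\<And>y. spectral_set_proj (?I r c) y = 0"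
      using UV \<V>(1) unfolding \<U>_def by blast
    have "spectral_set_proj U x = 0"
      using G.inter[of U "?I r c" x] U by (simp add: Int_absorb2 blinfun.zero_right subset_iff)
    moreover have "U \<in> sets borel" by (simp add: U)
    ultimately have "measure (spectral_dist x) U = 0"
      using spectral_set_proj[of U] by (metis norm_zero power_zero_numeral spectral_proj_def)
    then show ?thesis
      using finite_measure.emeasure_eq_measure[OF finite_spectral_dist] by (simp add: null_sets_def U(1))
  qed
  have "(\<Union>U\<in>\<V>. U) \<in> null_sets (spectral_dist x)"
    using \<V>(2) null by (rule null_sets_UN')
  then have "\<Union>\<U> \<in> null_sets (spectral_dist x)" using \<V>(3) by simp
  moreover have R: "- real_spectrum T \<in> sets borel"
    by (intro borel_comp borel_closed closed_real_spectrum sym)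
  ultimately have "- real_spectrum T \<in> null_sets (spectral_dist x)"
    by (intro null_sets_subset[OF _ _ cover]) simp_all
  then have "measure (spectral_dist x) (- real_spectrum T) = 0"
    by (simp add: measure_def null_setsD1)
  with spectral_set_proj[OF R] have "(norm (spectral_set_proj (- real_spectrum T) x))\<^sup>2 = 0"
    unfolding spectral_proj_def by simp
  then show ?thesis by simp
qed

section \<open>The spectral measure on the S-spectrum\<close>

definition clifford_spectral :: "'n clifford set \<Rightarrow> ('h, 'n) clop" where
  "clifford_spectral N = spectral_set_proj (cl_of_real -` N)"

abbreviation (input) spectrum_algebra :: "'n clifford measure" where
  "spectrum_algebra \<equiv> restrict_space borel (S_spectrum T)"

lemma spectrum_algebra_vimage:
  assumes "N \<in> sets spectrum_algebra"
  shows "cl_of_real -` N \<in> sets borel"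
proof -
  obtain B where B: "B \<in> sets borel" "N = S_spectrum T \<inter> B"
    using assms by (auto simp: sets_restrict_space)
  have "cl_of_real -` N = real_spectrum T \<inter> cl_of_real -` B"
    by (auto simp: B(2) real_spectrum_def)
  moreover have "cl_of_real -` B \<in> sets borel"
    using measurable_sets[OF borel_measurable_continuous_onI[OF continuous_cl_of_real] B(1)] by simp
  ultimately show ?thesis using closed_real_spectrum[OF sym] by (simp add: borel_closed)
qed

text \<open>The complement of the spectrum carries no mass. With \<open>M = UNIV\<close> this shows
  that the restricted measure still has total value \<open>id_blinfun\<close>.\<close>

lemma spectral_set_proj_spectrum:
  assumes M: "M \<in> sets borel"
  shows "spectral_set_proj (M \<inter> real_spectrum T) = spectral_set_proj M"
proof (rule blinfun_eqI)
  fix x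
  have R: "real_spectrum T \<in> sets borel" using closed_real_spectrum[OF sym] by (simp add: borel_closed)
  have "spectral_set_proj (M \<inter> - real_spectrum T) x = 0"
    using G.inter[OF M borel_comp[OF R], of x] by (simp add: spectral_set_proj_resolvent blinfun.zero_right)
  moreover have "M \<inter> real_spectrum T \<union> M \<inter> - real_spectrum T = M" by auto
  ultimately show "spectral_set_proj (M \<inter> real_spectrum T) x = spectral_set_proj M x"
    using G.union[of "M \<inter> real_spectrum T" "M \<inter> - real_spectrum T" x] M R
    by (simp add: borel_comp Int_assoc)
qed

lemma spectral_measure_clifford: "spectral_measure spectrum_algebra clifford_spectral"
  unfolding spectral_measure_def
proof (intro conjI ballI allI impI)
  show "orth_projection (clifford_spectral A)" if "A \<in> sets spectrum_algebra" for A
    using spectral_measure_real spectrum_algebra_vimage[OF that]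
    by (simp add: spectral_measure_def clifford_spectral_def)
  show "clifford_spectral (space spectrum_algebra) = id_blinfun"
    using spectral_set_proj_spectrum[of UNIV] spectral_set_proj_UNIV
    by (simp add: clifford_spectral_def space_restrict_space real_spectrum_def)
  fix A :: "nat \<Rightarrow> 'n clifford set" and x
  assume A: "range A \<subseteq> sets spectrum_algebra" "disjoint_family A"
  show "(\<lambda>i. clifford_spectral (A i) x) sums clifford_spectral (\<Union>i. A i) x"
    unfolding clifford_spectral_def vimage_UN
    using A spectrum_algebra_vimage
    by (intro spectral_set_proj_sums) (auto simp: disjoint_family_on_def)
qed

interpretation C: spectral_measure_space spectrum_algebra clifford_spectral
  by unfold_locales (rule spectral_measure_clifford)

lemma S_spectrum_vimage_Re: "s \<in> S_spectrum T \<Longrightarrow> cl_of_real (cl_Re s) = s"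
  using S_spectrum_real[OF self] by force

lemma cl_Re_bounded_measurable:
  "cl_Re \<in> borel_measurable spectrum_algebra" "bounded (cl_Re ` space spectrum_algebra)"
proof -
  show "cl_Re \<in> borel_measurable spectrum_algebra"
    using borel_measurable_cl_Re by (rule measurable_restrict_space1)
  have "\<bar>cl_Re s\<bar> \<le> norm T" if "s \<in> S_spectrum T" for s
    using that S_spectrum_vimage_Re[OF that] by (intro real_spectrum_bound[OF sym]) (simp add: real_spectrum_def)
  then show "bounded (cl_Re ` space spectrum_algebra)"
    by (auto simp: bounded_iff space_restrict_space)
qed

text \<open>The spectrum is cut into the level sets of \<open>floor_step\<close>. On each block the
  forms of \<open>T\<close> and of the integral both stay within \<open>1 / (k + 1)\<close> of the
  same constant, so the two operators differ by at most \<open>2 / (k + 1)\<close>.\<close>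

lemma clifford_integral: "C.bdd_int cl_Re = T"
proof -
  let ?f = "cl_Re :: 'n clifford \<Rightarrow> real"
  note f = cl_Re_bounded_measurable
  have "norm (T - C.bdd_int ?f) \<le> 2 / real (Suc k)" for k
  proof -
    let ?g = "floor_step ?f k"
    have g: "simple_function spectrum_algebra ?g" by (rule floor_step_simple[OF f])
    define A where "A c = ?g -` {c} \<inter> space spectrum_algebra" for c
    have A: "finite (?g ` space spectrum_algebra)" "disjoint_family_on A (?g ` space spectrum_algebra)"
      "\<And>c. A c \<in> sets spectrum_algebra" "(\<Union>c\<in>?g ` space spectrum_algebra. A c) = space spectrum_algebra"
      using simple_functionD[OF g] by (auto simp: A_def disjoint_family_on_def)
    have com: "clifford_spectral (A c) o\<^sub>L (T - C.bdd_int ?f) = (T - C.bdd_int ?f) o\<^sub>L clifford_spectral (A c)" for c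
    proof -
      have 1: "T o\<^sub>L clifford_spectral (A c) = clifford_spectral (A c) o\<^sub>L T"
        unfolding clifford_spectral_def
        by (rule spectral_set_proj_commute[OF spectrum_algebra_vimage[OF A(3)]]) simp
      have 2: "clifford_spectral (A c) o\<^sub>L C.bdd_int ?f = C.bdd_int ?f o\<^sub>L clifford_spectral (A c)"
        by (rule C.bdd_int_commute[OF f C.commute[OF A(3)]])
      show ?thesis
        using compose_eqD[OF 1] compose_eqD[OF 2] by (intro compose_eqI) (simp add: blinfun.bilinear_simps)
    qed
    show ?thesis
    proof (rule C.partition_norm_bound[where A = A, OF A com])
      show "sym_op (T - C.bdd_int ?f)" by (intro sym_op_diff sym C.bdd_int_sym f)
      fix c y assume y: "clifford_spectral (A c) y = y"
      define h where "h = 1 / real (Suc k)"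
      have h0: "h > 0" by (simp add: h_def)
      have h: "h \<ge> 0" "2 / real (Suc k) = 2 * h" by (simp_all add: h_def)
      have fA: "c \<le> ?f t" "?f t \<le> c + h" if "t \<in> A c" for t
        using that floor_step_bounds[where f = ?f and k = k and t = t] by (auto simp: A_def h_def)
      have "c * (norm y)\<^sup>2 \<le> C.bdd_int ?f y \<bullet> y"
        by (rule C.bdd_int_ge[OF f A(3) y fA(1)])
      moreover have "C.bdd_int ?f y \<bullet> y \<le> (c + h) * (norm y)\<^sup>2"
        by (rule C.bdd_int_le[OF f A(3) y fA(2)])
      moreover have "(c - h) * (norm y)\<^sup>2 \<le> T y \<bullet> y" "T y \<bullet> y \<le> (c + h) * (norm y)\<^sup>2"
      proof -
        note y' = y[unfolded clifford_spectral_def] and m = spectrum_algebra_vimage[OF A(3)[of c]]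
        have "c \<le> t" "t \<le> c + h" if "cl_of_real t \<in> A c" for t using fA[OF that] by simp_all
        \<comment> \<open>The lower half-line is enlarged to \<open>{c - h<..}\<close> because
          \<open>range_ge\<close> takes open half-lines; this accounts for the second
          \<open>h\<close> in the error.\<close>
        then have "cl_of_real -` A c \<subseteq> {..c + h}" "cl_of_real -` A c \<subseteq> {c - h<..}"
          using h0 by (fastforce intro: less_le_trans[of _ c])+
        then show "(c - h) * (norm y)\<^sup>2 \<le> T y \<bullet> y" "T y \<bullet> y \<le> (c + h) * (norm y)\<^sup>2"
          using range_ge[OF m _ y'] range_le[OF m _ y'] by blast+
      qed
      moreover have "h * (norm y)\<^sup>2 \<ge> 0" using h(1) by simp
      ultimately show "\<bar>(T - C.bdd_int ?f) y \<bullet> y\<bar> \<le> 2 / real (Suc k) * (norm y)\<^sup>2"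
        unfolding blinfun.diff_left inner_diff_left abs_le_iff h(2) left_diff_distrib distrib_right
        by linarith
    qed simp
  qed
  moreover have "(\<lambda>k. 2 / real (Suc k)) \<longlonglongrightarrow> 0"
    using LIMSEQ_Suc[OF lim_const_over_n[of 2]] by simp
  ultimately have "norm (T - C.bdd_int ?f) \<le> 0" by (intro LIMSEQ_le_const) auto
  then show ?thesis by simp
qed

lemma clifford_spectral_integral: "op_graph T = spectral_integral spectrum_algebra clifford_spectral cl_Re"
  using cl_Re_bounded_measurable(2) by (simp add: spectral_integral_def clifford_integral)

lemma clifford_commute_iff:
  "W o\<^sub>L T = T o\<^sub>L W \<longleftrightarrow> (\<forall>N\<in>sets spectrum_algebra. W o\<^sub>L clifford_spectral N = clifford_spectral N o\<^sub>L W)"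
proof
  assume "W o\<^sub>L T = T o\<^sub>L W"
  then show "\<forall>N\<in>sets spectrum_algebra. W o\<^sub>L clifford_spectral N = clifford_spectral N o\<^sub>L W"
    using spectral_set_proj_commute spectrum_algebra_vimage by (simp add: clifford_spectral_def)
next
  assume "\<forall>N\<in>sets spectrum_algebra. W o\<^sub>L clifford_spectral N = clifford_spectral N o\<^sub>L W"
  then show "W o\<^sub>L T = T o\<^sub>L W"
    using C.bdd_int_commute[OF cl_Re_bounded_measurable, of W] by (simp add: clifford_integral)
qed

section \<open>Uniqueness of the spectral measure\<close>

context
  fixes F :: "real set \<Rightarrow> ('h, 'n) clop"
  assumes F: "spectral_measure borel F" and TF: "op_graph T = spectral_integral borel F (\<lambda>t. t)"
begin

interpretation F: spectral_measure_space borel F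
  by unfold_locales (rule F)

text \<open>The identity is unbounded on the real line, so the integral is a strong limit of
  truncations. The sequence \<open>S\<close> may depend on \<open>x\<close>.\<close>

lemma bounding_limit:
  obtains S where "bounding_sequence borel F (\<lambda>t. t) S"
    "(\<lambda>j. F.bdd_int (\<lambda>t. t * indicator (S j) t) x) \<longlonglongrightarrow> T x"
proof -
  have "\<not> bounded (range (\<lambda>t::real. t))" by simp
  moreover have "(x, T x) \<in> spectral_integral borel F (\<lambda>t. t)" by (simp add: op_graph_def flip: TF)
  ultimately show thesis using that by (auto simp: spectral_integral_def)
qed

lemma truncation:
  assumes "bounding_sequence borel F (\<lambda>t. t) S"
  shows "S j \<in> sets borel" "(\<lambda>t. t * indicator (S j) t) \<in> borel_measurable borel"
    "bounded ((\<lambda>t. t * indicator (S j) t) ` space borel)"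
proof -
  show S: "S j \<in> sets borel" using assms by (auto simp: bounding_sequence_def)
  then show "(\<lambda>t. t * indicator (S j) t) \<in> borel_measurable borel" by measurable
  have "(\<lambda>t. t * indicator (S j) t) ` space borel \<subseteq> insert 0 (S j)" by (auto simp: indicator_def)
  moreover have "bounded (S j)" using assms by (auto simp: bounding_sequence_def)
  ultimately show "bounded ((\<lambda>t. t * indicator (S j) t) ` space borel)"
    using bounded_insert bounded_subset by blast
qed

lemma commute_F:
  assumes M: "M \<in> sets borel"
  shows "F M o\<^sub>L T = T o\<^sub>L F M"
proof -
  \<comment> \<open>Since \<open>S\<close> depends on the vector, commutation cannot be passed to
    the limit directly. The limit is taken at one vector to get invariance of ranges, applied below
    to \<open>M\<close> and its complement.\<close>
  have inv: "F N (T x) = T x" if N: "N \<in> sets borel" and x: "F N x = x" for N x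
  proof -
    obtain S where S: "bounding_sequence borel F (\<lambda>t. t) S"
      "(\<lambda>j. F.bdd_int (\<lambda>t. t * indicator (S j) t) x) \<longlonglongrightarrow> T x" by (rule bounding_limit)
    have "F N (F.bdd_int (\<lambda>t. t * indicator (S j) t) x) = F.bdd_int (\<lambda>t. t * indicator (S j) t) x" for j
      using compose_eqD[OF F.bdd_int_commute[OF truncation(2,3)[OF S(1)] F.commute[OF N]], of j x] x by simp
    moreover have "(\<lambda>j. F N (F.bdd_int (\<lambda>t. t * indicator (S j) t) x)) \<longlonglongrightarrow> F N (T x)"
      by (intro tendsto_intros S(2))
    ultimately show ?thesis using S(2) LIMSEQ_unique by fastforce
  qed
  show ?thesis
  proof (rule compose_eqI)
    fix x
    have M': "- M \<in> sets borel" using M by (rule borel_comp)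
    have x: "F (- M) y = y - F M y" for y using F.compl[OF M, of y] by (simp add: Compl_eq_Diff_UNIV)
    have "F M (T (F M x)) = T (F M x)" by (rule inv[OF M F.idem[OF M]])
    moreover have "F (- M) (T (F (- M) x)) = T (F (- M) x)" by (rule inv[OF M' F.idem[OF M']])
    ultimately show "F M (T x) = T (F M x)" by (simp add: x blinfun.bilinear_simps)
  qed
qed

text \<open>The truncated function equals \<open>t\<close> only on \<open>S j\<close>, so the bounds
  are first proved for the part \<open>y j\<close> of \<open>x\<close> carried by \<open>S j\<close>
  and then passed to the limit.\<close>

lemma F_range_bounds:
  assumes M: "M \<in> sets borel" and x: "F M x = x"
  shows F_range_le: "M \<subseteq> {..b} \<Longrightarrow> T x \<bullet> x \<le> b * (norm x)\<^sup>2"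
    and F_range_ge: "M \<subseteq> {b..} \<Longrightarrow> b * (norm x)\<^sup>2 \<le> T x \<bullet> x"
proof -
  obtain S where S: "bounding_sequence borel F (\<lambda>t. t) S"
    "(\<lambda>j. F.bdd_int (\<lambda>t. t * indicator (S j) t) x) \<longlonglongrightarrow> T x" by (rule bounding_limit)
  define J where "J j = F.bdd_int (\<lambda>t. t * indicator (S j) t)" for j
  note tr = truncation[OF S(1)]
  have J: "sym_op (J j)" for j unfolding J_def by (rule F.bdd_int_sym[OF tr(2,3)])
  have JF: "F N (J j y) = J j (F N y)" if "N \<in> sets borel" for N j y
    unfolding J_def by (rule compose_eqD[OF F.bdd_int_commute[OF tr(2,3) F.commute[OF that]]])
  define y where "y j = F (S j) x" for j
  have yS: "F (S j) (y j) = y j" for j unfolding y_def by (rule F.idem[OF tr(1)])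
  have yM: "F (M \<inter> S j) (y j) = y j" for j
    using F.inter[OF M tr(1), of j x] F.commute[OF M tr(1), of j] x F.idem[of "M \<inter> S j" x] M tr(1)[of j]
      compose_eqD[of "F M" "F (S j)" "F (S j)" "F M" x] by (simp add: y_def)
  \<comment> \<open>The remainder \<open>z\<close> is carried by the complement of
    \<open>S j\<close>, where the truncated function is zero; the mixed terms vanish by
    orthogonality.\<close>
  have Jx: "J j x \<bullet> x = J j (y j) \<bullet> y j" for j
  proof -
    define z where "z = x - y j"
    have "F (- S j) z = z"
      using F.compl[OF tr(1), of j z] yS[of j] by (simp add: z_def y_def Compl_eq_Diff_UNIV blinfun.bilinear_simps)
    then have "J j z \<bullet> z = 0"
      using F.bdd_int_le[OF tr(2,3)[of j] borel_comp[OF tr(1)[of j]], of z 0]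
        F.bdd_int_ge[OF tr(2,3)[of j] borel_comp[OF tr(1)[of j]], of z 0] by (simp add: J_def)
    moreover have "J j (y j) \<bullet> z = 0"
    proof -
      have "F (S j) z = 0" using yS[of j] by (simp add: z_def y_def blinfun.bilinear_simps)
      then show ?thesis
        using JF[OF tr(1), of j j "y j"] proj_op_inner[OF F.proj[OF tr(1)], of j "J j (y j)" z] yS[of j] by simp
    qed
    moreover have "J j z \<bullet> y j = J j (y j) \<bullet> z" using sym_opD[OF J, of j z "y j"] by (simp add: inner_commute)
    moreover have "x = y j + z" by (simp add: z_def)
    ultimately show ?thesis by (simp add: blinfun.add_right inner_add_left inner_add_right)
  qed
  have Jlim: "(\<lambda>j. J j x \<bullet> x) \<longlonglongrightarrow> T x \<bullet> x" unfolding J_def by (intro tendsto_intros S(2))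
  have "y \<longlonglongrightarrow> F (\<Union>j. S j) x"
    unfolding y_def using S(1) by (intro F.incseq_limit) (auto simp: bounding_sequence_def)
  then have "y \<longlonglongrightarrow> x" using S(1) by (simp add: bounding_sequence_def)
  then have ylim: "(\<lambda>j. b * (norm (y j))\<^sup>2) \<longlonglongrightarrow> b * (norm x)\<^sup>2" by (intro tendsto_intros)
  have MS: "M \<inter> S j \<in> sets borel" for j using M tr(1) by simp
  show "T x \<bullet> x \<le> b * (norm x)\<^sup>2" if b: "M \<subseteq> {..b}"
  proof (rule LIMSEQ_le[OF Jlim ylim], intro exI allI impI)
    show "J j x \<bullet> x \<le> b * (norm (y j))\<^sup>2" for j
      unfolding Jx unfolding J_def using b
      by (intro F.bdd_int_le[OF tr(2,3) MS yM]) auto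
  qed
  show "b * (norm x)\<^sup>2 \<le> T x \<bullet> x" if b: "M \<subseteq> {b..}"
  proof (rule LIMSEQ_le[OF ylim Jlim], intro exI allI impI)
    show "b * (norm (y j))\<^sup>2 \<le> J j x \<bullet> x" for j
      unfolding Jx unfolding J_def using b
      by (intro F.bdd_int_ge[OF tr(2,3) MS yM]) auto
  qed
qed

text \<open>\<open>F {..t}\<close> satisfies the characterisation of \<open>resolution t\<close>.
  Strictness on the kernel is the delicate half: the part of \<open>x\<close> beyond
  \<open>t + h n\<close> is shown to vanish, and \<open>h n\<close> tends to zero.\<close>

lemma F_atMost: "F {..t} = resolution t"
proof (rule spectral_below_unique)
  show "F {..t} o\<^sub>L resolution t = resolution t o\<^sub>L F {..t}"
    by (rule resolution_commute[OF commute_F]) simp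
  show "spectral_below T t (resolution t)" by (rule resolution_below)
  show "spectral_below T t (F {..t})"
    unfolding spectral_below_def
  proof (intro conjI allI impI)
    show "proj_op (F {..t})" by (rule F.proj) simp
    show "F {..t} o\<^sub>L T = T o\<^sub>L F {..t}" by (rule commute_F) simp
    show "T x \<bullet> x \<le> t * (norm x)\<^sup>2" if "F {..t} x = x" for x
      by (rule F_range_le[OF _ that]) auto
    fix x assume x: "F {..t} x = 0" and le: "T x \<bullet> x \<le> t * (norm x)\<^sup>2"
    have "- {..t} = {t<..}" by auto
    then have x': "F {t<..} x = x" using F.compl[of "{..t}" x] x by (simp add: Compl_eq_Diff_UNIV)
    define h where "h n = 1 / real (Suc n)" for n
    have "F {t + h n<..} x = 0" for n
    proof -
      let ?A = "{t + h n<..}" and ?B = "{t<..t + h n}"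
      define y z where "y = F ?A x" and "z = F ?B x"
      have h: "h n > 0" by (simp add: h_def)
      have "?A \<union> ?B = {t<..}" "?A \<inter> ?B = {}" using h by auto
      then have xyz: "x = y + z" using F.union[of ?A ?B x] x' by (simp add: y_def z_def)
      have y: "F ?A y = y" and z: "F ?B z = z" unfolding y_def z_def by (rule F.idem; simp)+
      have orth: "u \<bullet> v = 0" if "F ?A u = u" "F ?B v = v" for u v
        using proj_op_inner[OF F.proj[of ?A], of u v] that F.disjoint[of ?B ?A v] by fastforce
      have Ty: "F ?A (T y) = T y" using compose_eqD[OF commute_F[of ?A], of y] y by simp
      have Tz: "F ?B (T z) = T z" using compose_eqD[OF commute_F[of ?B], of z] z by simp
      have "T y \<bullet> z = 0" "T z \<bullet> y = 0" "y \<bullet> z = 0"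
        using orth[OF Ty z] orth[OF y Tz] orth[OF y z] by (auto simp: inner_commute)
      then have eq: "T x \<bullet> x = T y \<bullet> y + T z \<bullet> z" "(norm x)\<^sup>2 = (norm y)\<^sup>2 + (norm z)\<^sup>2"
        by (simp_all add: xyz blinfun.add_right inner_add_left inner_add_right power2_norm_eq_inner
            inner_commute del: dot_square_norm)
      have "(t + h n) * (norm y)\<^sup>2 \<le> T y \<bullet> y" by (rule F_range_ge[OF _ y]) auto
      moreover have "t * (norm z)\<^sup>2 \<le> T z \<bullet> z" by (rule F_range_ge[OF _ z]) auto
      \<comment> \<open>Beyond \<open>t + h n\<close> the form gains \<open>h n\<close> over
        \<open>t\<close>, and on the remaining part it is at least \<open>t\<close>; the assumed
        upper bound \<open>t\<close> leaves no room for the gain.\<close>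
      ultimately have "h n * (norm y)\<^sup>2 \<le> 0" using le eq by (simp add: algebra_simps)
      then have "y = 0" using h by (simp add: mult_le_0_iff)
      then show ?thesis by (simp add: y_def)
    qed
    moreover have "(\<lambda>n. F {t + h n<..} x) \<longlonglongrightarrow> F (\<Union>n. {t + h n<..}) x"
    proof (rule F.incseq_limit)
      show "incseq (\<lambda>n. {t + h n<..})"
        by (rule incseq_SucI) (auto simp: h_def elim!: le_less_trans[rotated] intro!: frac_le)
    qed auto
    moreover have "(\<Union>n. {t + h n<..}) = {t<..}"
    proof -
      have "\<exists>n. t + h n < s" if "t < s" for s
        using reals_Archimedean[of "s - t"] that by (auto simp: h_def inverse_eq_divide algebra_simps)
      moreover have "t < s" if "t + h n < s" for n s
        using that by (auto simp: h_def elim!: le_less_trans[rotated])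
      ultimately show ?thesis by auto
    qed
    ultimately show "x = 0" using x' by (simp add: LIMSEQ_const_iff)
  qed
qed

text \<open>Both measures agree on half-lines, and the sets on which they agree form a Dynkin
  system.\<close>

lemma F_eq:
  assumes "M \<in> sets borel"
  shows "F M = spectral_set_proj M"
proof -
  have bor: "sets borel = sigma_sets UNIV (range (\<lambda>a::real. {..a}))"
    using arg_cong[OF borel_eq_atMost, of sets] by simp
  have "Int_stable (range (\<lambda>a::real. {..a}))" by (auto simp: Int_stable_def)
  moreover have "range (\<lambda>a::real. {..a}) \<subseteq> Pow UNIV" by simp
  moreover have "M \<in> sigma_sets UNIV (range (\<lambda>a::real. {..a}))" using assms bor by simp
  ultimately show ?thesis
  proof (induction rule: sigma_sets_induct_disjoint)
    case (basic A)
    then show ?case by (auto simp: F_atMost spectral_set_proj_atMost)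
  next
    case empty
    show ?case by (rule blinfun_eqI) (simp add: F.E_empty G.E_empty)
  next
    case (compl A)
    then show ?case
      using F.compl[of A] G.compl[of A] bor by (intro blinfun_eqI) simp
  next
    case (union A)
    then have A: "range A \<subseteq> sets borel" using bor by simp
    show ?case
    proof (rule blinfun_eqI)
      show "F (\<Union>i. A i) x = spectral_set_proj (\<Union>i. A i) x" for x
        using F.sums[OF A union(1), of x] G.sums[OF A union(1), of x] union(3)
        by (intro sums_unique2[of "\<lambda>i. F (A i) x"]) simp_all
    qed
  qed
qed

lemma clifford_spectral_eq_F:
  assumes M: "M \<in> sets borel"
  shows "clifford_spectral (cl_of_real ` M \<inter> S_spectrum T) = F M"
proof -
  have "inj (cl_of_real :: real \<Rightarrow> 'n clifford)" by (metis cl_Re_of_real injI)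
  then have "cl_of_real -` (cl_of_real ` M \<inter> S_spectrum T) = M \<inter> real_spectrum T"
    by (simp add: vimage_Int inj_vimage_image_eq real_spectrum_def)
  then show ?thesis
    by (simp add: clifford_spectral_def spectral_set_proj_spectrum[OF M] F_eq[OF M])
qed

end

end

theorem theorem6p0p1:
  fixes T :: "('h::{real_inner,banach}, 'n::{finite,linorder}) clop"
  assumes "right_linear T" and "self_adjoint T"
  shows "\<exists>E :: 'n clifford set \<Rightarrow> ('h, 'n) clop.
     spectral_measure (restrict_space borel (S_spectrum T)) E \<and>
     op_graph T = spectral_integral (restrict_space borel (S_spectrum T)) E cl_Re \<and>
     (\<forall>F :: real set \<Rightarrow> ('h, 'n) clop.
        spectral_measure borel F \<longrightarrow> op_graph T = spectral_integral borel F (\<lambda>t. t) \<longrightarrow>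
        (\<forall>M\<in>sets borel. E (cl_of_real ` M \<inter> S_spectrum T) = F M)) \<and>
     (\<forall>W :: ('h, 'n) clop. right_linear W \<longrightarrow>
        (W o\<^sub>L T = T o\<^sub>L W \<longleftrightarrow>
         (\<forall>M\<in>sets (restrict_space borel (S_spectrum T)). W o\<^sub>L E M = E M o\<^sub>L W)))"
  using spectral_measure_clifford[OF assms] clifford_spectral_integral[OF assms]
    clifford_spectral_eq_F[OF assms] clifford_commute_iff[OF assms]
  by (intro exI[of _ "clifford_spectral T"]) blast

end
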